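(* For every $n\ge 2$, the metric space $(B_T^n,d)$ is not a median space.
   Context: For $v \in \mathbb{R}^n$ let $\|v\|_T = \sum_{i=1}^n |v_i|$, and let $B_T^n = \{x \in \mathbb{R}^n : \|x\|_T < 1\}$. $\Gamma(p,q)$ is the set of maps $\gamma : [0,1] \to B_T^n$ all of whose components are absolutely continuous, with $\gamma(0)=p$ and $\gamma(1)=q$. The length of such a curve is $\mathcal{L}(\gamma) = \int_0^1 \frac{\|\gamma'(t)\|_T}{1-\|\gamma(t)\|_T^2}\,dt$, and $d(p,q) = \inf_{\gamma\in\Gamma(p,q)} \mathcal{L}(\gamma)$. The interval of $p,q\in B_T^n$ is $[p,q]=\{x\in B_T^n : d(p,q)=d(p,x)+d(x,q)\}$. A triple $x,y,z$ supports a median if $[x,y]\cap[y,z]\cap[z,x]$ consists of exactly one point. A metric space is a median space if every triple of its points supports a median. *)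

theory Defs
  imports "HOL-Analysis.Analysis"
begin

definition taxicab_norm :: "real ^ 'n \<Rightarrow> real" where
  "taxicab_norm v = (\<Sum>i\<in>UNIV. \<bar>v $ i\<bar>)"

definition taxicab_ball :: "(real ^ 'n) set" where
  "taxicab_ball = {x. taxicab_norm x < 1}"

(* The epsilon-delta definition. A finite family of non-overlapping subintervals [u, v] of [a, b]
   is encoded as a finite set D of pairs (u, v) with pairwise disjoint open intervals. *)
definition absolutely_continuous_fun_on :: "real \<Rightarrow> real \<Rightarrow> (real \<Rightarrow> real) \<Rightarrow> bool" where
  "absolutely_continuous_fun_on a b f \<longleftrightarrow>
     (\<forall>\<epsilon>>0. \<exists>\<delta>>0. \<forall>D :: (real \<times> real) set.
        finite D \<and> (\<forall>(u, v)\<in>D. a \<le> u \<and> u \<le> v \<and> v \<le> b) \<and>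
        disjoint_family_on (\<lambda>(u, v). {u<..<v}) D \<and> (\<Sum>(u, v)\<in>D. v - u) < \<delta>
        \<longrightarrow> (\<Sum>(u, v)\<in>D. \<bar>f v - f u\<bar>) < \<epsilon>)"

(* Curves are total functions on the reals, of which only the restriction to [0, 1] matters. *)
definition curves :: "real ^ 'n \<Rightarrow> real ^ 'n \<Rightarrow> (real \<Rightarrow> real ^ 'n) set" where
  "curves p q = {\<gamma>. \<gamma> ` {0..1} \<subseteq> taxicab_ball \<and>
     (\<forall>i. absolutely_continuous_fun_on 0 1 (\<lambda>t. \<gamma> t $ i)) \<and> \<gamma> 0 = p \<and> \<gamma> 1 = q}"

(* An absolutely continuous curve is differentiable almost everywhere, so the arbitrary value of
   the derivative at the remaining points does not affect the Lebesgue integral. *)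
definition curve_length :: "(real \<Rightarrow> real ^ 'n) \<Rightarrow> real" where
  "curve_length \<gamma> =
     (LINT t:{0..1}|lebesgue.
        taxicab_norm (vector_derivative \<gamma> (at t within {0..1})) / (1 - (taxicab_norm (\<gamma> t))\<^sup>2))"

definition taxicab_dist :: "real ^ 'n \<Rightarrow> real ^ 'n \<Rightarrow> real" where
  "taxicab_dist p q = (INF \<gamma>\<in>curves p q. curve_length \<gamma>)"

definition metric_interval :: "'a set \<Rightarrow> ('a \<Rightarrow> 'a \<Rightarrow> real) \<Rightarrow> 'a \<Rightarrow> 'a \<Rightarrow> 'a set" where
  "metric_interval M d p q = {x\<in>M. d p q = d p x + d x q}"

definition supports_median :: "'a set \<Rightarrow> ('a \<Rightarrow> 'a \<Rightarrow> real) \<Rightarrow> 'a \<Rightarrow> 'a \<Rightarrow> 'a \<Rightarrow> bool" where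
  "supports_median M d x y z \<longleftrightarrow>
     (\<exists>!m. m \<in> metric_interval M d x y \<inter> metric_interval M d y z \<inter> metric_interval M d z x)"

(* The metric axioms for d are not part of this predicate, so that its negation
   asserts that some triple of points fails to support a median. *)
definition median_space :: "'a set \<Rightarrow> ('a \<Rightarrow> 'a \<Rightarrow> real) \<Rightarrow> bool" where
  "median_space M d \<longleftrightarrow> (\<forall>x\<in>M. \<forall>y\<in>M. \<forall>z\<in>M. supports_median M d x y z)"

end

theory Submission
  imports Defs
begin

text \<open>
Write \<open>|w|\<close> for the taxicab norm and \<open>A\<close> for \<open>artanh\<close>. For a point \<open>a\<close> with nonnegative coordinates let
\<open>|a \<and> w|\<close> be the norm of the coordinatewise meet of \<open>a\<close> with the positive part of \<open>w\<close>. The function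
\<open>w \<mapsto> A |w| - 2 A |a \<and> w|\<close> is 1-Lipschitz for \<open>d\<close> because \<open>A\<close> is increasing and convex on \<open>[0, 1)\<close>,
so it bounds distances from below. The bound is attained by the curve that goes straight down from
\<open>p\<close> to a common lower bound of \<open>p\<close> and \<open>q\<close> and up again to \<open>q\<close>.

For \<open>p = (1/2, 0)\<close>, \<open>q = (1/4, 1/4)\<close>, \<open>r = (0, 1/2)\<close> in two of the coordinates, a median \<open>m\<close> would satisfy
\<open>A |m| \<le> A |p \<and> m| + A |r \<and> m|\<close>. Since \<open>A\<close> is strictly superadditive, one of these two meets vanishes,
and then \<open>m\<close> violates the interval condition for \<open>q\<close> and the corresponding end point.

Lipschitz estimates for curve lengths need the fundamental theorem of calculus for absolutely
continuous functions. Differentiability almost everywhere comes from a Vitali covering argument: if the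
slopes oscillated on a set of positive measure, then refining a partition of almost maximal variation
would increase the variation by a fixed amount.
\<close>

section \<open>Differentiability of functions of bounded variation\<close>

text \<open>These are the families of intervals quantified over in
  \<open>absolutely_continuous_fun_on\<close>; with a name of their own they also serve for bounded
  variation and for refinement arguments.\<close>

definition nonoverlapping :: "real \<Rightarrow> real \<Rightarrow> (real \<times> real) set \<Rightarrow> bool" where
  "nonoverlapping a b D \<longleftrightarrow> finite D \<and> (\<forall>(u, v)\<in>D. a \<le> u \<and> u \<le> v \<and> v \<le> b) \<and>
     disjoint_family_on (\<lambda>(u, v). {u<..<v}) D"

lemma nonoverlapping_mono:
  assumes "nonoverlapping c d D" "a \<le> c" "d \<le> b"
  shows "nonoverlapping a b D"
  using assms unfolding nonoverlapping_def by force

lemma nonoverlapping_insert: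
  assumes D: "nonoverlapping a b D" and "a \<le> u" "u \<le> v" "v \<le> b"
    and disj: "\<And>p q. (p, q) \<in> D \<Longrightarrow> {u<..<v} \<inter> {p<..<q} = {}"
  shows "nonoverlapping a b (insert (u, v) D)"
proof -
  have "disjoint_family_on (\<lambda>(u, v). {u<..<v}) (insert (u, v) D)"
    unfolding disjoint_family_on_def
  proof (intro ballI impI)
    fix I J assume IJ: "I \<in> insert (u, v) D" "J \<in> insert (u, v) D" "I \<noteq> J"
    have *: "(case (u, v) of (u, v) \<Rightarrow> {u<..<v}) \<inter> (case J of (u, v) \<Rightarrow> {u<..<v}) = {}" if "J \<in> D" for J
      using disj[of "fst J" "snd J"] that by (simp add: case_prod_unfold)
    consider "I = (u, v)" "J \<in> D" | "J = (u, v)" "I \<in> D" | "I \<in> D" "J \<in> D" using IJ by blast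
    then show "(case I of (u, v) \<Rightarrow> {u<..<v}) \<inter> (case J of (u, v) \<Rightarrow> {u<..<v}) = {}"
    proof cases
      case 1
      then show ?thesis using *[of J] by simp
    next
      case 2
      then show ?thesis using *[of I] by (simp add: Int_commute)
    next
      case 3
      then show ?thesis
        using D IJ(3) unfolding nonoverlapping_def disjoint_family_on_def by blast
    qed
  qed
  then show ?thesis
    using assms unfolding nonoverlapping_def by auto
qed

text \<open>The interiors of the three pieces are nonempty and lie inside \<open>{p<..<q}\<close>,
  which every member of \<open>R\<close> avoids. Hence no piece occurs in \<open>R\<close>, and a
  sum over the refined family splits off three separate terms.\<close>

lemma nonoverlapping_split:
  assumes D: "nonoverlapping a b D" and pq: "(p, q) \<in> D" and "p < u" "u < v" "v < q"
  defines "R \<equiv> D - {(p, q)}"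
  shows "nonoverlapping a b (insert (p, u) (insert (u, v) (insert (v, q) R)))"
    and "(p, u) \<notin> R" "(u, v) \<notin> R" "(v, q) \<notin> R"
proof -
  have R: "nonoverlapping a b R"
    using D unfolding nonoverlapping_def R_def disjoint_family_on_def by auto
  have ab: "a \<le> p" "q \<le> b"
    using D pq unfolding nonoverlapping_def by auto
  have disj: "{p<..<q} \<inter> {p'<..<q'} = {}" if "(p', q') \<in> R" for p' q'
    using D pq that unfolding nonoverlapping_def R_def disjoint_family_on_def by fastforce
  have sub: "{p<..<u} \<subseteq> {p<..<q}" "{u<..<v} \<subseteq> {p<..<q}" "{v<..<q} \<subseteq> {p<..<q}"
    using assms by auto
  have disj': "{p<..<u} \<inter> {p'<..<q'} = {}" "{u<..<v} \<inter> {p'<..<q'} = {}"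
     "{v<..<q} \<inter> {p'<..<q'} = {}" if "(p', q') \<in> R" for p' q'
    using disj[OF that] sub by blast+
  have ne: "{p<..<u} \<noteq> {}" "{u<..<v} \<noteq> {}" "{v<..<q} \<noteq> {}"
    using assms by auto
  show "(p, u) \<notin> R" "(u, v) \<notin> R" "(v, q) \<notin> R"
    using disj' ne by blast+
  have 1: "nonoverlapping a b (insert (v, q) R)"
    by (rule nonoverlapping_insert[OF R]) (use ab assms disj'(3) in auto)
  have 2: "nonoverlapping a b (insert (u, v) (insert (v, q) R))"
  proof (rule nonoverlapping_insert[OF 1])
    fix p' q' assume "(p', q') \<in> insert (v, q) R"
    then consider "(p', q') = (v, q)" | "(p', q') \<in> R" by blast
    then show "{u<..<v} \<inter> {p'<..<q'} = {}"
      using disj'(2)[of p' q'] by cases auto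
  qed (use ab assms in auto)
  show "nonoverlapping a b (insert (p, u) (insert (u, v) (insert (v, q) R)))"
  proof (rule nonoverlapping_insert[OF 2])
    fix p' q' assume "(p', q') \<in> insert (u, v) (insert (v, q) R)"
    then consider "(p', q') = (u, v)" | "(p', q') = (v, q)" | "(p', q') \<in> R" by blast
    then show "{p<..<u} \<inter> {p'<..<q'} = {}"
      using disj'(1)[of p' q'] assms by cases auto
  qed (use ab assms in auto)
qed

text \<open>Intervals on which \<open>h\<close> has slope at least \<open>\<alpha>\<close> in absolute value, and which lie either inside a
  member of \<open>D\<close> where the slope opposes the sign \<open>s\<close>, or away from \<open>D\<close>: inserting one of them into \<open>D\<close>
  raises the signed variation by at least \<open>\<alpha>\<close> times its length.\<close>

definition admissible ::
  "real \<Rightarrow> real \<Rightarrow> (real \<Rightarrow> real) \<Rightarrow> real \<Rightarrow> (real \<times> real) set \<Rightarrow> (real \<times> real \<Rightarrow> real) \<Rightarrow> (real \<times> real) set" where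
  "admissible a b h \<alpha> D s = {(u, v). a \<le> u \<and> u < v \<and> v \<le> b \<and>
     ((\<exists>(p, q)\<in>D. p < u \<and> v < q \<and> s (p, q) * (h v - h u) \<le> - \<alpha> * (v - u)) \<or>
      (\<forall>(p, q)\<in>D. {p..q} \<inter> {u..v} = {}) \<and> \<bar>h v - h u\<bar> \<ge> \<alpha> * (v - u))}"

text \<open>The members of \<open>F\<close> are inserted into \<open>D\<close> one at a time. Inside
  a member of \<open>D\<close> the new piece takes the opposite sign, away from \<open>D\<close> it
  takes the sign of its own increment. Either way the signed sum grows by at least
  \<open>\<alpha> * (v - u)\<close>, and it can never exceed \<open>V\<close>.\<close>

lemma signed_variation_refine:
  fixes h :: "real \<Rightarrow> real"
  assumes V: "\<And>D s. nonoverlapping a b D \<Longrightarrow> (\<And>I. I \<in> D \<Longrightarrow> \<bar>s I\<bar> \<le> 1) \<Longrightarrow>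
      (\<Sum>(u, v)\<in>D. s (u, v) * (h v - h u)) \<le> V"
    and \<alpha>: "\<alpha> > 0"
    and F: "finite F" "pairwise (\<lambda>(u, v) (u', v'). disjnt {u..v} {u'..v'}) F"
      "F \<subseteq> admissible a b h \<alpha> D s"
    and D: "nonoverlapping a b D" "\<And>I. I \<in> D \<Longrightarrow> \<bar>s I\<bar> \<le> 1"
  shows "(\<Sum>(u, v)\<in>D. s (u, v) * (h v - h u)) + \<alpha> * (\<Sum>(u, v)\<in>F. v - u) \<le> V"
  using F D
proof (induction F arbitrary: D s rule: finite_induct)
  case empty
  then show ?case using V by simp
next
  case (insert I F)
  obtain u v where I: "I = (u, v)" by fastforce
  have finD: "finite D" using insert.prems(3) by (simp add: nonoverlapping_def)
  have uv: "a \<le> u" "u < v" "v \<le> b"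
    using insert.prems(2) by (auto simp: I admissible_def)
  have disjF: "v < u' \<or> v' < u" if "(u', v') \<in> F" for u' v'
  proof -
    have "u' < v'" using insert.prems(2) that by (auto simp: admissible_def)
    moreover have "disjnt {u..v} {u'..v'}"
      using insert.prems(1) insert.hyps(2) that unfolding I pairwise_def by fastforce
    ultimately show ?thesis
      using uv(2) by (auto simp: disjnt_def)
  qed
  have pwF: "pairwise (\<lambda>(u, v) (u', v'). disjnt {u..v} {u'..v'}) F"
    using insert.prems(1) by (rule pairwise_subset) auto
  have sumF: "(\<Sum>(u, v)\<in>insert I F. v - u) = (v - u) + (\<Sum>(u, v)\<in>F. v - u)"
    using insert.hyps by (simp add: I)
  have "(u, v) \<in> admissible a b h \<alpha> D s" using insert.prems(2) by (auto simp: I)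
  then consider (inside) p q where "(p, q) \<in> D" "p < u" "v < q" "s (p, q) * (h v - h u) \<le> - \<alpha> * (v - u)"
    | (outside) "\<And>p q. (p, q) \<in> D \<Longrightarrow> {p..q} \<inter> {u..v} = {}" "\<bar>h v - h u\<bar> \<ge> \<alpha> * (v - u)"
    unfolding admissible_def by blast
  then show ?case
  proof cases
    case inside
    define R where "R = D - {(p, q)}"
    define D' where "D' = insert (p, u) (insert (u, v) (insert (v, q) R))"
    define \<sigma> where "\<sigma> = s (p, q)"
    \<comment> \<open>The outer pieces keep the sign of \<open>(p, q)\<close> and only the middle
      one is reversed, so the signed sum changes by exactly
      \<open>- 2 * (\<sigma> * (h v - h u))\<close>.\<close>
    define s' where "s' = s((p, u) := \<sigma>, (u, v) := - \<sigma>, (v, q) := \<sigma>)"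
    note split = nonoverlapping_split[OF insert.prems(3) inside(1,2) uv(2) inside(3), folded R_def, folded D'_def]
    have s'R: "s' J = s J" if "J \<in> R" for J
      using that split unfolding s'_def by auto
    have \<sigma>: "\<bar>\<sigma>\<bar> \<le> 1" using insert.prems(4)[OF inside(1)] by (simp add: \<sigma>_def)
    have finR: "finite R" using finD by (simp add: R_def)
    have vals: "s' (p, u) = \<sigma>" "s' (u, v) = - \<sigma>" "s' (v, q) = \<sigma>"
      using uv inside by (auto simp: s'_def)
    have "(\<Sum>(u, v)\<in>D'. s' (u, v) * (h v - h u)) =
        \<sigma> * (h u - h p) - \<sigma> * (h v - h u) + \<sigma> * (h q - h v) + (\<Sum>(u, v)\<in>R. s' (u, v) * (h v - h u))"
      unfolding D'_def using finR split(2-4) uv inside vals by simp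
    also have "(\<Sum>(u, v)\<in>R. s' (u, v) * (h v - h u)) = (\<Sum>(u, v)\<in>R. s (u, v) * (h v - h u))"
      by (intro sum.cong refl) (auto simp: s'R)
    finally have sD': "(\<Sum>(u, v)\<in>D'. s' (u, v) * (h v - h u)) =
        \<sigma> * (h q - h p) - 2 * (\<sigma> * (h v - h u)) + (\<Sum>(u, v)\<in>R. s (u, v) * (h v - h u))"
      by (simp add: algebra_simps)
    have sD: "(\<Sum>(u, v)\<in>D. s (u, v) * (h v - h u)) =
        \<sigma> * (h q - h p) + (\<Sum>(u, v)\<in>R. s (u, v) * (h v - h u))"
      using finD inside(1) by (simp add: R_def \<sigma>_def sum.remove)
    \<comment> \<open>The remaining members of \<open>F\<close> miss \<open>{u..v}\<close>. One that
      lay strictly inside \<open>(p, q)\<close> now lies strictly inside \<open>(p, u)\<close> or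
      \<open>(v, q)\<close>, where the sign is unchanged; so admissibility survives and the
      induction hypothesis applies.\<close>
    have "F \<subseteq> admissible a b h \<alpha> D' s'"
    proof clarify
      fix u' v' assume uv': "(u', v') \<in> F"
      then have adm: "(u', v') \<in> admissible a b h \<alpha> D s" using insert.prems(2) by auto
      then have o: "a \<le> u'" "u' < v'" "v' \<le> b" by (auto simp: admissible_def)
      from adm consider (i) p' q' where "(p', q') \<in> D" "p' < u'" "v' < q'" "s (p', q') * (h v' - h u') \<le> - \<alpha> * (v' - u')"
        | (o) "\<And>p' q'. (p', q') \<in> D \<Longrightarrow> {p'..q'} \<inter> {u'..v'} = {}" "\<bar>h v' - h u'\<bar> \<ge> \<alpha> * (v' - u')"
        unfolding admissible_def by blast
      then show "(u', v') \<in> admissible a b h \<alpha> D' s'"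
      proof cases
        case i
        show ?thesis
        proof (cases "(p', q') = (p, q)")
          case True
          consider "v < u'" | "v' < u" using disjF[OF uv'] by blast
          then show ?thesis
          proof cases
            case 1
            then have "(v, q) \<in> D' \<and> v < u' \<and> v' < q \<and> s' (v, q) * (h v' - h u') \<le> - \<alpha> * (v' - u')"
              using True i vals by (auto simp: D'_def \<sigma>_def)
            then show ?thesis using o unfolding admissible_def by blast
          next
            case 2
            then have "(p, u) \<in> D' \<and> p < u' \<and> v' < u \<and> s' (p, u) * (h v' - h u') \<le> - \<alpha> * (v' - u')"
              using True i vals by (auto simp: D'_def \<sigma>_def)
            then show ?thesis using o unfolding admissible_def by blast
          qed
        next
          case False
          then have "(p', q') \<in> R" using i by (simp add: R_def)
          then have "(p', q') \<in> D' \<and> p' < u' \<and> v' < q' \<and> s' (p', q') * (h v' - h u') \<le> - \<alpha> * (v' - u')"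
            using i s'R by (auto simp: D'_def)
          then show ?thesis using o unfolding admissible_def by blast
        qed
      next
        case o': o
        have pq: "{p..q} \<inter> {u'..v'} = {}" using o'(1)[OF inside(1)] .
        have "{p'..q'} \<inter> {u'..v'} = {}" if pq': "(p', q') \<in> D'" for p' q'
        proof -
          consider "(p', q') \<in> R" | "{p'..q'} \<subseteq> {p..q}"
            using pq' inside uv by (force simp: D'_def)
          then show ?thesis by cases (use o' pq R_def in blast)+
        qed
        then show ?thesis using o o' unfolding admissible_def by blast
      qed
    qed
    moreover have "\<bar>s' J\<bar> \<le> 1" if "J \<in> D'" for J
      using that insert.prems(4)[of J] \<sigma> vals s'R[of J] unfolding D'_def R_def by auto
    ultimately have "(\<Sum>(u, v)\<in>D'. s' (u, v) * (h v - h u)) + \<alpha> * (\<Sum>(u, v)\<in>F. v - u) \<le> V"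
      using insert.IH[OF pwF _ split(1)] by blast
    moreover have "2 * (\<sigma> * (h v - h u)) \<le> - \<alpha> * (v - u)"
    proof -
      have "\<alpha> * (v - u) \<ge> 0" using \<alpha> uv by simp
      then show ?thesis using inside(4) by (simp add: \<sigma>_def)
    qed
    ultimately show ?thesis
      unfolding sumF sD sD' by (simp add: algebra_simps)
  next
    case outside
    \<comment> \<open>With this sign the new term contributes
      \<open>\<bar>h v - h u\<bar>\<close>.\<close>
    define s' where "s' = s((u, v) := sgn (h v - h u))"
    have nD: "(u, v) \<notin> D" using outside(1)[of u v] uv by auto
    have s'D: "s' J = s J" if "J \<in> D" for J using that nD by (auto simp: s'_def)
    have no: "nonoverlapping a b (insert (u, v) D)"
    proof (rule nonoverlapping_insert[OF insert.prems(3)])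
      fix p q assume "(p, q) \<in> D"
      from outside(1)[OF this] show "{u<..<v} \<inter> {p<..<q} = {}"
        using greaterThanLessThan_subseteq_atLeastAtMost_iff by fastforce
    qed (use uv in auto)
    have "F \<subseteq> admissible a b h \<alpha> (insert (u, v) D) s'"
    proof clarify
      fix u' v' assume uv': "(u', v') \<in> F"
      then have adm: "(u', v') \<in> admissible a b h \<alpha> D s" using insert.prems(2) by auto
      then have o: "a \<le> u'" "u' < v'" "v' \<le> b" by (auto simp: admissible_def)
      from adm consider (i) p' q' where "(p', q') \<in> D" "p' < u'" "v' < q'" "s (p', q') * (h v' - h u') \<le> - \<alpha> * (v' - u')"
        | (o) "\<And>p' q'. (p', q') \<in> D \<Longrightarrow> {p'..q'} \<inter> {u'..v'} = {}" "\<bar>h v' - h u'\<bar> \<ge> \<alpha> * (v' - u')"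
        unfolding admissible_def by blast
      then show "(u', v') \<in> admissible a b h \<alpha> (insert (u, v) D) s'"
      proof cases
        case i
        then have "(p', q') \<in> insert (u, v) D \<and> p' < u' \<and> v' < q' \<and> s' (p', q') * (h v' - h u') \<le> - \<alpha> * (v' - u')"
          using s'D by auto
        then show ?thesis using o unfolding admissible_def by blast
      next
        case o': o
        have "{u..v} \<inter> {u'..v'} = {}" using disjF[OF uv'] by auto
        then show ?thesis using o o' unfolding admissible_def by blast
      qed
    qed
    moreover have "\<bar>s' J\<bar> \<le> 1" if "J \<in> insert (u, v) D" for J
      using that insert.prems(4)[of J] by (auto simp: s'_def abs_sgn_eq)
    ultimately have "(\<Sum>(u, v)\<in>insert (u, v) D. s' (u, v) * (h v - h u)) + \<alpha> * (\<Sum>(u, v)\<in>F. v - u) \<le> V"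
      using insert.IH[OF pwF _ no] by blast
    moreover have "(\<Sum>(u, v)\<in>insert (u, v) D. s' (u, v) * (h v - h u)) =
        \<bar>h v - h u\<bar> + (\<Sum>(u, v)\<in>D. s' (u, v) * (h v - h u))"
      using finD nD by (simp add: s'_def abs_sgn mult.commute)
    moreover have "(\<Sum>(u, v)\<in>D. s' (u, v) * (h v - h u)) = (\<Sum>(u, v)\<in>D. s (u, v) * (h v - h u))"
      by (intro sum.cong refl) (auto simp: s'D)
    ultimately show ?thesis
      using outside(2) unfolding sumF by (simp add: algebra_simps)
  qed
qed

text \<open>Vitali's theorem selects countably many disjoint admissible intervals that cover
  \<open>E\<close> up to a null set. Inserting finitely many of them into \<open>D\<close> gains
  \<open>\<alpha>\<close> times their total length, so this length is at most the gap below
  \<open>V\<close> divided by \<open>\<alpha>\<close>; the bound passes to the countable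
  union.\<close>

lemma measure_le_variation_gain:
  fixes h :: "real \<Rightarrow> real"
  assumes V: "\<And>D s. nonoverlapping a b D \<Longrightarrow> (\<And>I. I \<in> D \<Longrightarrow> \<bar>s I\<bar> \<le> 1) \<Longrightarrow>
      (\<Sum>(u, v)\<in>D. s (u, v) * (h v - h u)) \<le> V"
    and \<alpha>: "\<alpha> > 0"
    and D: "nonoverlapping a b D" "\<And>I. I \<in> D \<Longrightarrow> \<bar>s I\<bar> \<le> 1"
    and cover: "\<And>x d. x \<in> E \<Longrightarrow> d > 0 \<Longrightarrow>
      \<exists>u v. (u, v) \<in> admissible a b h \<alpha> D s \<and> u \<le> x \<and> x \<le> v \<and> v - u < d"
  obtains T where "E \<subseteq> T" "T \<in> lmeasurable"
    "measure lebesgue T \<le> (V - (\<Sum>(u, v)\<in>D. s (u, v) * (h v - h u))) / \<alpha>"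
proof -
  define K where "K = admissible a b h \<alpha> D s"
  \<comment> \<open>The covering theorem is about balls, so each interval is presented by its
    midpoint and half its length.\<close>
  define c :: "real \<times> real \<Rightarrow> real" where "c = (\<lambda>(u, v). (u + v) / 2)"
  define r :: "real \<times> real \<Rightarrow> real" where "r = (\<lambda>(u, v). (v - u) / 2)"
  have less: "u < v" if "(u, v) \<in> K" for u v
    using that by (auto simp: K_def admissible_def)
  have cball: "cball (c I) (r I) = {fst I..snd I}" for I
    by (auto simp: c_def r_def cball_eq_atLeastAtMost field_simps split: prod.split)
  obtain C where C: "countable C" "C \<subseteq> K"
      "pairwise (\<lambda>i j. disjnt (cball (c i) (r i)) (cball (c j) (r j))) C"
      "negligible (E - (\<Union>i\<in>C. cball (c i) (r i)))"
  proof (rule Vitali_covering_theorem_cballs[of K r E c])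
    show "0 < r i" if "i \<in> K" for i
      using less[of "fst i" "snd i"] that by (auto simp: r_def split: prod.split)
    show "\<exists>i. i \<in> K \<and> x \<in> cball (c i) (r i) \<and> r i < d" if xd: "x \<in> E" "0 < d" for x d
    proof -
      obtain u v where uv: "(u, v) \<in> K" "u \<le> x" "x \<le> v" "v - u < d"
        using cover[OF xd] by (auto simp: K_def)
      moreover have "r (u, v) < d" using uv less[OF uv(1)] by (simp add: r_def)
      ultimately show ?thesis by (intro exI[of _ "(u, v)"]) (simp add: cball)
    qed
  qed
  define B where "B = (V - (\<Sum>(u, v)\<in>D. s (u, v) * (h v - h u))) / \<alpha>"
  have fin: "measure lebesgue (\<Union>I\<in>F. cball (c I) (r I)) \<le> B" if F: "F \<subseteq> C" "finite F" for F
  proof -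
    have "measure lebesgue (\<Union>I\<in>F. cball (c I) (r I)) \<le> (\<Sum>I\<in>F. measure lebesgue (cball (c I) (r I)))"
      by (intro measure_UNION_le F) auto
    also have "\<dots> = (\<Sum>(u, v)\<in>F. v - u)"
    proof (rule sum.cong)
      fix I assume "I \<in> F"
      then have "fst I < snd I" using F C(2) less[of "fst I" "snd I"] by auto
      then show "measure lebesgue (cball (c I) (r I)) = (case I of (u, v) \<Rightarrow> v - u)"
        by (simp add: cball case_prod_unfold)
    qed simp
    also have "\<dots> \<le> B"
    proof -
      have "pairwise (\<lambda>(u, v) (u', v'). disjnt {u..v} {u'..v'}) F"
        using pairwise_subset[OF C(3) F(1)] by (auto simp: cball case_prod_unfold)
      then have "(\<Sum>(u, v)\<in>D. s (u, v) * (h v - h u)) + \<alpha> * (\<Sum>(u, v)\<in>F. v - u) \<le> V"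
        using F C(2) by (intro signed_variation_refine[OF V \<alpha> F(2) _ _ D]) (simp_all add: K_def)
      then show ?thesis using \<alpha> by (simp add: B_def field_simps)
    qed
    finally show ?thesis .
  qed
  define U where "U = (\<Union>I\<in>C. cball (c I) (r I))"
  have U: "U \<in> lmeasurable" "measure lebesgue U \<le> B"
    unfolding U_def
    by (rule fmeasurable_UN_bound[OF C(1) _ fin], simp, assumption+)
       (rule measure_UN_bound[OF C(1) _ fin], simp, assumption+)
  have neg: "negligible (E - U)" using C(4) by (simp add: U_def)
  show thesis
  \<comment> \<open>The selected intervals miss only a null part of \<open>E\<close>; adjoining it
    covers all of \<open>E\<close> without changing the measure.\<close>
  proof (rule that[of "U \<union> (E - U)"])
    show "U \<union> (E - U) \<in> lmeasurable"
      by (rule fmeasurable.Un[OF U(1) negligible_imp_measurable[OF neg]])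
    have "measure lebesgue (U \<union> (E - U)) = measure lebesgue U"
      using neg unfolding negligible_iff_null_sets by (rule measure_Un_null_set[OF fmeasurableD[OF U(1)]])
    then show "measure lebesgue (U \<union> (E - U)) \<le> (V - (\<Sum>(u, v)\<in>D. s (u, v) * (h v - h u))) / \<alpha>"
      using U(2) by (simp add: B_def)
  qed auto
qed

section \<open>Null sets of points with unbounded or oscillating slopes\<close>

lemma signed_variation_le:
  fixes h :: "real \<Rightarrow> real"
  assumes "\<And>I. I \<in> D \<Longrightarrow> \<bar>s I\<bar> \<le> 1"
  shows "(\<Sum>(u, v)\<in>D. s (u, v) * (h v - h u)) \<le> (\<Sum>(u, v)\<in>D. \<bar>h v - h u\<bar>)"
proof (rule sum_mono, clarify)
  fix u v assume "(u, v) \<in> D"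
  then have "\<bar>s (u, v)\<bar> * \<bar>h v - h u\<bar> \<le> 1 * \<bar>h v - h u\<bar>"
    by (intro mult_right_mono assms) auto
  then show "s (u, v) * (h v - h u) \<le> \<bar>h v - h u\<bar>"
    by (metis abs_ge_self abs_mult mult_1 order_trans)
qed

text \<open>The covering estimate is applied to the empty family, for which admissibility just means
  slope at least \<open>M\<close> in absolute value. The outer measure of \<open>E\<close> is then
  at most \<open>B / M\<close> for every positive \<open>M\<close>.\<close>

lemma negligible_unbounded_slopes:
  fixes h :: "real \<Rightarrow> real"
  assumes bv: "\<And>D. nonoverlapping a b D \<Longrightarrow> (\<Sum>(u, v)\<in>D. \<bar>h v - h u\<bar>) \<le> B"
    and cover: "\<And>x d M. x \<in> E \<Longrightarrow> d > 0 \<Longrightarrow>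
      \<exists>u v. a \<le> u \<and> u < v \<and> v \<le> b \<and> u \<le> x \<and> x \<le> v \<and> v - u < d \<and> \<bar>h v - h u\<bar> \<ge> M * (v - u)"
  shows "negligible E"
  unfolding negligible_outer_le
proof (intro allI impI)
  fix e :: real assume e: "e > 0"
  have "B \<ge> 0" using bv[of "{}"] by (simp add: nonoverlapping_def disjoint_family_on_def)
  \<comment> \<open>This makes \<open>B / M \<le> e\<close>; the summand 1 keeps \<open>M\<close>
    positive when \<open>B = 0\<close>.\<close>
  define M where "M = (B + 1) / e"
  have M: "M > 0" using e \<open>B \<ge> 0\<close> by (simp add: M_def)
  obtain T where T: "E \<subseteq> T" "T \<in> lmeasurable"
    "measure lebesgue T \<le> (B - (\<Sum>(u, v)\<in>{}. 0 * (h v - h u))) / M"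
  proof (rule measure_le_variation_gain[of a b h B M "{}" "\<lambda>_. 0" E])
    fix D s assume "nonoverlapping a b D" "\<And>I. I \<in> D \<Longrightarrow> \<bar>s I :: real\<bar> \<le> 1"
    then show "(\<Sum>(u, v)\<in>D. s (u, v) * (h v - h u)) \<le> B"
      using signed_variation_le[of D s h] bv[of D] by fastforce
  next
    fix x d :: real assume "x \<in> E" "0 < d"
    then show "\<exists>u v. (u, v) \<in> admissible a b h M {} (\<lambda>_. 0) \<and> u \<le> x \<and> x \<le> v \<and> v - u < d"
      using cover[of x d M] by (force simp: admissible_def)
  qed (use M in \<open>auto simp: nonoverlapping_def disjoint_family_on_def\<close>)
  have "B / M \<le> e" using e \<open>B \<ge> 0\<close> by (simp add: M_def field_simps)
  then show "\<exists>T. E \<subseteq> T \<and> T \<in> lmeasurable \<and> measure lebesgue T \<le> e"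
    using T by (intro exI[of _ T]) auto
qed

text \<open>A family \<open>D\<close> of almost maximal variation leaves little room for a gain. Yet
  near a point of \<open>E\<close> there are short intervals of both slopes, so one of them always
  opposes the sign that \<open>D\<close> has there, and the covering estimate bounds the outer
  measure of \<open>E\<close> by the small remaining gap.\<close>

lemma negligible_oscillating_slopes:
  fixes h :: "real \<Rightarrow> real"
  assumes bv: "\<And>D. nonoverlapping a b D \<Longrightarrow> (\<Sum>(u, v)\<in>D. \<bar>h v - h u\<bar>) \<le> B"
    and \<alpha>: "\<alpha> > 0"
    and up: "\<And>x d. x \<in> E \<Longrightarrow> d > 0 \<Longrightarrow>
      \<exists>u v. a \<le> u \<and> u < v \<and> v \<le> b \<and> u \<le> x \<and> x \<le> v \<and> v - u < d \<and> h v - h u \<ge> \<alpha> * (v - u)"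
    and down: "\<And>x d. x \<in> E \<Longrightarrow> d > 0 \<Longrightarrow>
      \<exists>u v. a \<le> u \<and> u < v \<and> v \<le> b \<and> u \<le> x \<and> x \<le> v \<and> v - u < d \<and> h v - h u \<le> - \<alpha> * (v - u)"
  shows "negligible E"
  unfolding negligible_outer_le
proof (intro allI impI)
  fix e :: real assume e: "e > 0"
  define W where "W = {\<Sum>(u, v)\<in>D. \<bar>h v - h u\<bar> |D. nonoverlapping a b D}"
  define V where "V = Sup W"
  have bdd: "bdd_above W" using bv unfolding W_def bdd_above_def by blast
  have ne: "W \<noteq> {}"
  proof -
    have "nonoverlapping a b {}" by (simp add: nonoverlapping_def disjoint_family_on_def)
    then show ?thesis unfolding W_def by blast
  qed
  \<comment> \<open>The measure bound divides the gap by \<open>\<alpha>\<close>, so a gap below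
    \<open>\<alpha> * e\<close> yields measure at most \<open>e\<close>.\<close>
  have "\<exists>w\<in>W. V - \<alpha> * e < w"
    using less_cSup_iff[OF ne bdd, of "V - \<alpha> * e"] \<alpha> e by (simp add: V_def)
  then obtain D where D: "nonoverlapping a b D" "V - \<alpha> * e < (\<Sum>(u, v)\<in>D. \<bar>h v - h u\<bar>)"
    unfolding W_def by auto
  have finD: "finite D" using D by (simp add: nonoverlapping_def)
  define s :: "real \<times> real \<Rightarrow> real" where "s = (\<lambda>(u, v). if h v \<ge> h u then 1 else - 1)"
  \<comment> \<open>An admissible interval lies strictly inside a member of \<open>D\<close> or away
    from all of them, so the finitely many end points are set aside as a null set.\<close>
  define P where "P = fst ` D \<union> snd ` D"
  have sum_s: "(\<Sum>(u, v)\<in>D. s (u, v) * (h v - h u)) = (\<Sum>(u, v)\<in>D. \<bar>h v - h u\<bar>)"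
    by (intro sum.cong) (auto simp: s_def)
  obtain T where T: "E - P \<subseteq> T" "T \<in> lmeasurable"
    "measure lebesgue T \<le> (V - (\<Sum>(u, v)\<in>D. s (u, v) * (h v - h u))) / \<alpha>"
  proof (rule measure_le_variation_gain[of a b h V \<alpha> D s "E - P"])
    fix D' s' assume D': "nonoverlapping a b D'" "\<And>I. I \<in> D' \<Longrightarrow> \<bar>s' I :: real\<bar> \<le> 1"
    have "(\<Sum>(u, v)\<in>D'. \<bar>h v - h u\<bar>) \<le> V"
      unfolding V_def using D' by (intro cSup_upper bdd) (auto simp: W_def)
    then show "(\<Sum>(u, v)\<in>D'. s' (u, v) * (h v - h u)) \<le> V"
      using signed_variation_le[of D' s' h] D' by fastforce
  next
    fix x d :: real assume x: "x \<in> E - P" and d: "d > 0"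
    show "\<exists>u v. (u, v) \<in> admissible a b h \<alpha> D s \<and> u \<le> x \<and> x \<le> v \<and> v - u < d"
    proof (cases "\<exists>(p, q)\<in>D. p \<le> x \<and> x \<le> q")
      case True
      then obtain p q where pq: "(p, q) \<in> D" "p \<le> x" "x \<le> q" by blast
      have "p \<in> P" "q \<in> P" using pq unfolding P_def by force+
      then have pxq: "p < x" "x < q" using x pq by (auto simp: less_le)
      define d' where "d' = min d (min (x - p) (q - x))"
      have "d' > 0" using d pxq by (simp add: d'_def)
      obtain u v where uv: "a \<le> u" "u < v" "v \<le> b" "u \<le> x" "x \<le> v" "v - u < d'"
        "s (p, q) * (h v - h u) \<le> - \<alpha> * (v - u)"
      \<comment> \<open>Where \<open>h\<close> does not fall from \<open>p\<close> to
        \<open>q\<close> the sign is 1 and a falling interval opposes it; otherwise a rising one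
        does.\<close>
      proof (cases "h q \<ge> h p")
        case True
        then show ?thesis using that down[of x d'] x \<open>d' > 0\<close> by (auto simp: s_def)
      next
        case False
        then show ?thesis using that up[of x d'] x \<open>d' > 0\<close> by (auto simp: s_def)
      qed
      moreover have "p < u" "v < q" using uv by (auto simp: d'_def)
      ultimately have "(u, v) \<in> admissible a b h \<alpha> D s"
        using pq unfolding admissible_def by blast
      then show ?thesis using uv by (auto simp: d'_def)
    next
      case False
      define U where "U = (\<Union>(p, q)\<in>D. {p..q})"
      have "closed U" unfolding U_def using finD by (intro closed_UN) auto
      moreover have "x \<notin> U" using False by (auto simp: U_def)
      ultimately obtain d0 where d0: "d0 > 0" "ball x d0 \<subseteq> - U"
        using open_contains_ball_eq[of "- U"] by (auto simp: open_Compl)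
      obtain u v where uv: "a \<le> u" "u < v" "v \<le> b" "u \<le> x" "x \<le> v" "v - u < min d d0"
        "h v - h u \<ge> \<alpha> * (v - u)"
        using up[of x "min d d0"] x d d0 by auto
      have "{u..v} \<subseteq> ball x d0" using uv by (auto simp: dist_real_def)
      then have "U \<inter> {u..v} = {}" using d0(2) by blast
      moreover have "{p..q} \<subseteq> U" if "(p, q) \<in> D" for p q
        using that unfolding U_def by blast
      ultimately have "{p..q} \<inter> {u..v} = {}" if "(p, q) \<in> D" for p q
        using that by blast
      then have "\<forall>(p, q)\<in>D. {p..q} \<inter> {u..v} = {}" by blast
      then have "(u, v) \<in> admissible a b h \<alpha> D s"
        using uv unfolding admissible_def by auto
      then show ?thesis using uv by auto
    qed
  qed (use D \<alpha> in \<open>auto simp: s_def split: prod.splits\<close>)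
  have P: "negligible P" using finD by (simp add: P_def negligible_finite)
  have "measure lebesgue T \<le> e"
  proof -
    have "(V - (\<Sum>(u, v)\<in>D. \<bar>h v - h u\<bar>)) / \<alpha> \<le> e"
      using D(2) \<alpha> by (simp add: field_simps)
    then show ?thesis using T(3) unfolding sum_s by linarith
  qed
  moreover have "measure lebesgue (T \<union> P) = measure lebesgue T"
    using T P by (intro measure_Un_null_set fmeasurableD) (simp_all add: negligible_iff_null_sets)
  moreover have "T \<union> P \<in> lmeasurable"
    by (rule fmeasurable.Un[OF T(2) negligible_imp_measurable[OF P]])
  ultimately show "\<exists>T. E \<subseteq> T \<and> T \<in> lmeasurable \<and> measure lebesgue T \<le> e"
    using T(1) by (intro exI[of _ "T \<union> P"]) auto
qed

text \<open>The limit is the supremum of the eventual lower bounds, that is, the limit inferior.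
  Above it, \<open>Q\<close> frequently lies below a rational \<open>r1\<close>, and then it cannot
  frequently exceed a larger rational \<open>r2\<close>. Restricting to rational thresholds leaves
  only countably many exceptional sets later on.\<close>

lemma tendsto_if_not_oscillating:
  fixes Q :: "'a \<Rightarrow> real"
  assumes F: "F \<noteq> bot" and bdd: "eventually (\<lambda>y. \<bar>Q y\<bar> \<le> M) F"
    and osc: "\<And>r1 r2. r1 \<in> \<rat> \<Longrightarrow> r2 \<in> \<rat> \<Longrightarrow> r1 < r2 \<Longrightarrow>
      \<not> (frequently (\<lambda>y. Q y < r1) F \<and> frequently (\<lambda>y. Q y > r2) F)"
  obtains L where "(Q \<longlongrightarrow> L) F"
proof -
  define S where "S = {r. eventually (\<lambda>y. r \<le> Q y) F}"
  have le_M: "r \<le> M" if "r \<in> S" for r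
  proof -
    have "eventually (\<lambda>y. r \<le> M) F"
      using that bdd unfolding S_def mem_Collect_eq by eventually_elim auto
    then show ?thesis using F by (simp add: eventually_const_iff)
  qed
  have bddS: "bdd_above S" using le_M by (auto simp: bdd_above_def)
  have "eventually (\<lambda>y. - M \<le> Q y) F" using bdd by eventually_elim auto
  then have ne: "S \<noteq> {}" by (auto simp: S_def)
  have "(Q \<longlongrightarrow> Sup S) F"
  proof (rule order_tendstoI)
    fix r assume "r < Sup S"
    then obtain r' where "r' \<in> S" "r < r'" using less_cSup_iff[OF ne bddS] by auto
    then show "eventually (\<lambda>y. r < Q y) F"
      unfolding S_def by (auto elim: eventually_mono)
  next
    fix r assume "Sup S < r"
    then obtain r2 where r2: "r2 \<in> \<rat>" "Sup S < r2" "r2 < r" using Rats_dense_in_real by blast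
    then obtain r1 where r1: "r1 \<in> \<rat>" "Sup S < r1" "r1 < r2" using Rats_dense_in_real by blast
    have "r1 \<notin> S" using r1 cSup_upper[OF _ bddS] by force
    then have "frequently (\<lambda>y. Q y < r1) F"
      by (simp add: S_def frequently_def not_less)
    then have "\<not> frequently (\<lambda>y. Q y > r2) F" using osc r1 r2 by blast
    then have "eventually (\<lambda>y. Q y \<le> r2) F" by (simp add: frequently_def not_less)
    then show "eventually (\<lambda>y. Q y < r) F" by eventually_elim (use r2 in auto)
  qed
  then show thesis using that by blast
qed

lemma nonoverlapping_sum_le_measure:
  assumes D: "nonoverlapping a b D" and sub: "\<And>u v. (u, v) \<in> D \<Longrightarrow> {u<..<v} \<subseteq> U"
    and U: "U \<in> lmeasurable"
  shows "(\<Sum>(u, v)\<in>D. v - u) \<le> measure lebesgue U"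
proof -
  have "(\<Sum>(u, v)\<in>D. v - u) = (\<Sum>I\<in>D. measure lebesgue (case I of (u, v) \<Rightarrow> {u<..<v}))"
    using D by (intro sum.cong) (auto simp: nonoverlapping_def)
  also have "\<dots> = measure lebesgue (\<Union>I\<in>D. case I of (u, v) \<Rightarrow> {u<..<v})"
  proof (rule measure_finite_Union[symmetric])
    show "finite D" "disjoint_family_on (\<lambda>(u, v). {u<..<v}) D"
      using D by (auto simp: nonoverlapping_def)
    show "emeasure lebesgue (case I of (u, v) \<Rightarrow> {u<..<v}) \<noteq> \<infinity>" if "I \<in> D" for I
      using emeasure_lborel_box_finite[of "fst I" "snd I"] by (auto split: prod.splits)
  qed auto
  also have "\<dots> \<le> measure lebesgue U"
    using sub D by (intro measure_mono_fmeasurable U sets.finite_UN)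
      (auto simp: nonoverlapping_def)
  finally show ?thesis .
qed

text \<open>The difference quotient is symmetric in its two points, so a nearby \<open>y\<close> on
  either side of \<open>x\<close> gives an interval with \<open>x\<close> as one of its end points.
  This is the form in which the covering lemmas take slopes.\<close>

lemma frequently_at_difference_quotient:
  fixes h :: "real \<Rightarrow> real"
  assumes fr: "frequently (\<lambda>y. P ((h y - h x) / (y - x))) (at x)" and x: "a < x" "x < b" and "d > 0"
  shows "\<exists>u v. a \<le> u \<and> u < v \<and> v \<le> b \<and> u \<le> x \<and> x \<le> v \<and> v - u < d \<and> P ((h v - h u) / (v - u))"
proof -
  have "min d (min (x - a) (b - x)) > 0" using assms by auto
  then obtain y where y: "y \<noteq> x" "dist y x < min d (min (x - a) (b - x))" "P ((h y - h x) / (y - x))"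
    using fr unfolding frequently_at by blast
  show ?thesis
  proof (cases "y < x")
    case True
    have "(h x - h y) / (x - y) = (h y - h x) / (y - x)"
      by (metis minus_diff_eq minus_divide_divide)
    then show ?thesis using y True x
      by (intro exI[of _ y] exI[of _ x]) (auto simp: dist_real_def)
  next
    case False
    then show ?thesis using y x
      by (intro exI[of _ x] exI[of _ y]) (auto simp: dist_real_def)
  qed
qed

text \<open>If the derivative at an interior point fails to exist, the difference quotients there
  are unbounded or frequently lie below \<open>r1\<close> and above \<open>r2\<close> for some
  rationals \<open>r1 < r2\<close>. Both kinds of points form null sets, the second as a countable
  union.\<close>

lemma bounded_variation_differentiable_ae:
  fixes h :: "real \<Rightarrow> real"
  assumes bv: "\<And>D. nonoverlapping a b D \<Longrightarrow> (\<Sum>(u, v)\<in>D. \<bar>h v - h u\<bar>) \<le> B"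
  shows "negligible {x \<in> {a..b}. \<not> h differentiable (at x)}"
proof -
  define Q where "Q x y = (h y - h x) / (y - x)" for x y
  define N where "N = {x \<in> {a<..<b}. \<forall>M. frequently (\<lambda>y. \<bar>Q x y\<bar> \<ge> M) (at x)}"
  define E where "E = (\<lambda>(r1, r2). {x \<in> {a<..<b}.
    frequently (\<lambda>y. Q x y < r1) (at x) \<and> frequently (\<lambda>y. Q x y > r2) (at x)})"
  define R where "R = {(r1, r2). r1 \<in> \<rat> \<and> r2 \<in> \<rat> \<and> r1 < (r2::real)}"
  have "negligible N"
  proof (rule negligible_unbounded_slopes[OF bv])
    fix x d M :: real assume "x \<in> N" "d > 0"
    then have "frequently (\<lambda>y. \<bar>(h y - h x) / (y - x)\<bar> \<ge> M) (at x)" "a < x" "x < b"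
      by (auto simp: N_def Q_def)
    from frequently_at_difference_quotient[OF this \<open>d > 0\<close>]
    obtain u v where uv: "a \<le> u" "u < v" "v \<le> b" "u \<le> x" "x \<le> v" "v - u < d"
      "M \<le> \<bar>(h v - h u) / (v - u)\<bar>" by blast
    moreover have "M * (v - u) \<le> \<bar>h v - h u\<bar>"
      using uv by (simp add: pos_le_divide_eq)
    ultimately show "\<exists>u v. a \<le> u \<and> u < v \<and> v \<le> b \<and> u \<le> x \<and> x \<le> v \<and> v - u < d \<and> \<bar>h v - h u\<bar> \<ge> M * (v - u)"
      by blast
  qed
  moreover have "negligible (\<Union>r\<in>R. E r)"
  proof (rule negligible_countable_Union)
    have "R \<subseteq> \<rat> \<times> \<rat>" by (auto simp: R_def)
    then show "countable (E ` R)"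
      using countable_rat by (meson countable_SIGMA countable_image countable_subset)
    fix S assume "S \<in> E ` R"
    then obtain r1 r2 where r: "r1 < r2" "S = E (r1, r2)" by (auto simp: R_def)
    \<comment> \<open>Subtracting a linear function makes the two slope bounds symmetric about 0.\<close>
    define c where "c = (r1 + r2) / 2"
    define g where "g t = h t - c * t" for t
    have "negligible (E (r1, r2))"
    proof (rule negligible_oscillating_slopes[where h = g and \<alpha> = "(r2 - r1) / 2"])
      fix D assume D: "nonoverlapping a b D"
      have "(\<Sum>(u, v)\<in>D. \<bar>g v - g u\<bar>) \<le> (\<Sum>(u, v)\<in>D. \<bar>h v - h u\<bar> + \<bar>c\<bar> * (v - u))"
      proof (rule sum_mono, clarify)
        fix u v assume "(u, v) \<in> D"
        then have "u \<le> v" using D by (auto simp: nonoverlapping_def)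
        have "\<bar>g v - g u\<bar> = \<bar>(h v - h u) - c * (v - u)\<bar>" by (simp add: g_def algebra_simps)
        also have "\<dots> \<le> \<bar>h v - h u\<bar> + \<bar>c * (v - u)\<bar>" by linarith
        finally show "\<bar>g v - g u\<bar> \<le> \<bar>h v - h u\<bar> + \<bar>c\<bar> * (v - u)"
          using \<open>u \<le> v\<close> by (simp add: abs_mult)
      qed
      also have "\<dots> = (\<Sum>(u, v)\<in>D. \<bar>h v - h u\<bar>) + \<bar>c\<bar> * (\<Sum>(u, v)\<in>D. v - u)"
        by (simp add: sum.distrib sum_distrib_left case_prod_unfold)
      also have "\<dots> \<le> B + \<bar>c\<bar> * measure lebesgue {a..b}"
      proof (intro add_mono bv D mult_left_mono nonoverlapping_sum_le_measure[OF D])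
        show "{u<..<v} \<subseteq> {a..b}" if "(u, v) \<in> D" for u v
          using D that by (auto simp: nonoverlapping_def)
      qed auto
      finally show "(\<Sum>(u, v)\<in>D. \<bar>g v - g u\<bar>) \<le> B + \<bar>c\<bar> * measure lebesgue {a..b}" .
    next
      fix x d :: real assume x: "x \<in> E (r1, r2)" and d: "d > 0"
      then have "frequently (\<lambda>y. (h y - h x) / (y - x) > r2) (at x)" "a < x" "x < b"
        by (auto simp: E_def Q_def)
      from frequently_at_difference_quotient[OF this d]
      obtain u v where uv: "a \<le> u" "u < v" "v \<le> b" "u \<le> x" "x \<le> v" "v - u < d"
        "r2 < (h v - h u) / (v - u)" by blast
      then have "r2 * (v - u) < h v - h u" by (simp add: pos_less_divide_eq)
      then have "(r2 - r1) / 2 * (v - u) \<le> g v - g u"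
        by (simp add: g_def c_def field_simps)
      then show "\<exists>u v. a \<le> u \<and> u < v \<and> v \<le> b \<and> u \<le> x \<and> x \<le> v \<and> v - u < d \<and>
          (r2 - r1) / 2 * (v - u) \<le> g v - g u"
        using uv by blast
    next
      fix x d :: real assume x: "x \<in> E (r1, r2)" and d: "d > 0"
      then have "frequently (\<lambda>y. (h y - h x) / (y - x) < r1) (at x)" "a < x" "x < b"
        by (auto simp: E_def Q_def)
      from frequently_at_difference_quotient[OF this d]
      obtain u v where uv: "a \<le> u" "u < v" "v \<le> b" "u \<le> x" "x \<le> v" "v - u < d"
        "(h v - h u) / (v - u) < r1" by blast
      then have "h v - h u < r1 * (v - u)" by (simp add: pos_divide_less_eq)
      then have "g v - g u \<le> - ((r2 - r1) / 2) * (v - u)"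
        by (simp add: g_def c_def field_simps)
      then show "\<exists>u v. a \<le> u \<and> u < v \<and> v \<le> b \<and> u \<le> x \<and> x \<le> v \<and> v - u < d \<and>
          g v - g u \<le> - ((r2 - r1) / 2) * (v - u)"
        using uv by blast
    qed (use r in auto)
    then show "negligible S" using r by simp
  qed
  \<comment> \<open>At the end points the two-sided derivative depends on values of \<open>h\<close>
    outside \<open>{a..b}\<close>, so they join the exceptional set.\<close>
  moreover have "negligible {a, b}" by (simp add: negligible_finite)
  ultimately have neg: "negligible ({a, b} \<union> N \<union> (\<Union>r\<in>R. E r))"
    by (intro negligible_Un)
  have "h differentiable (at x)" if x: "x \<in> {a..b}" "x \<notin> {a, b} \<union> N \<union> (\<Union>r\<in>R. E r)" for x
  proof -
    have ab: "x \<in> {a<..<b}" using x by auto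
    obtain M where M: "\<not> frequently (\<lambda>y. \<bar>Q x y\<bar> \<ge> M) (at x)"
      using x ab by (auto simp: N_def)
    obtain L where "(Q x \<longlongrightarrow> L) (at x)"
    proof (rule tendsto_if_not_oscillating[of "at x" "Q x" M])
      show "eventually (\<lambda>y. \<bar>Q x y\<bar> \<le> M) (at x)"
        using M unfolding frequently_def not_not by eventually_elim auto
      fix r1 r2 :: real assume "r1 \<in> \<rat>" "r2 \<in> \<rat>" "r1 < r2"
      then have "(r1, r2) \<in> R" by (simp add: R_def)
      then have "x \<notin> E (r1, r2)" using x(2) by blast
      then show "\<not> (frequently (\<lambda>y. Q x y < r1) (at x) \<and> frequently (\<lambda>y. Q x y > r2) (at x))"
        using ab by (simp add: E_def)
    qed auto
    then have "(h has_field_derivative L) (at x)"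
      by (simp add: has_field_derivative_iff Q_def[abs_def])
    then show ?thesis using real_differentiable_def by blast
  qed
  then have "{x \<in> {a..b}. \<not> h differentiable (at x)} \<subseteq> {a, b} \<union> N \<union> (\<Union>r\<in>R. E r)" by blast
  then show ?thesis using neg negligible_subset by blast
qed

section \<open>Absolutely continuous functions\<close>

lemma absolutely_continuous_fun_on_iff:
  "absolutely_continuous_fun_on a b f \<longleftrightarrow> (\<forall>\<epsilon>>0. \<exists>\<delta>>0. \<forall>D. nonoverlapping a b D \<and>
     (\<Sum>(u, v)\<in>D. v - u) < \<delta> \<longrightarrow> (\<Sum>(u, v)\<in>D. \<bar>f v - f u\<bar>) < \<epsilon>)"
  unfolding absolutely_continuous_fun_on_def nonoverlapping_def by simp

lemma absolutely_continuous_fun_on_subinterval: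
  assumes "absolutely_continuous_fun_on a b f" "a \<le> c" "d \<le> b"
  shows "absolutely_continuous_fun_on c d f"
  using assms nonoverlapping_mono[of c d _ a b] unfolding absolutely_continuous_fun_on_iff by meson

text \<open>The Riemann sums of a gauge integral are compared with the telescoping sum of
  increments. Tags outside \<open>N\<close> cost at most \<open>c\<close> times the length of their
  interval by differentiability; the intervals tagged in \<open>N\<close> have total length below
  \<open>\<delta>\<close>, so absolute continuity makes their increments small.\<close>

lemma absolutely_continuous_fun_on_has_integral:
  fixes f :: "real \<Rightarrow> real"
  assumes ac: "absolutely_continuous_fun_on a b f" and "a \<le> b" and N: "negligible N"
    and deriv: "\<And>x. x \<in> {a..b} - N \<Longrightarrow> (f has_vector_derivative g x) (at x within {a..b})"
  shows "(g has_integral (f b - f a)) {a..b}"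
proof -
  \<comment> \<open>With the value 0 on \<open>N\<close>, tags in \<open>N\<close> contribute
    nothing to the Riemann sums; the change on a null set is undone at the end.\<close>
  define g0 where "g0 x = (if x \<in> N then 0 else g x)" for x
  have "(g0 has_integral (f b - f a)) {a..b}"
    unfolding has_integral_real
  proof (intro allI impI)
    fix e :: real assume e: "e > 0"
    \<comment> \<open>This makes \<open>c * (b - a) < e / 2\<close>; the summand 1 keeps the
      denominator positive when \<open>a = b\<close>.\<close>
    define c where "c = e / (2 * (b - a + 1))"
    have c: "c > 0" using e \<open>a \<le> b\<close> by (simp add: c_def)
    have cba: "c * (b - a) < e / 2"
      using e \<open>a \<le> b\<close> by (simp add: c_def field_simps)
    have "e / 2 > 0" using e by simp
    with ac obtain \<delta> where \<delta>: "\<delta> > 0"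
      "\<And>D. nonoverlapping a b D \<Longrightarrow> (\<Sum>(u, v)\<in>D. v - u) < \<delta> \<Longrightarrow> (\<Sum>(u, v)\<in>D. \<bar>f v - f u\<bar>) < e / 2"
      unfolding absolutely_continuous_fun_on_iff by meson
    obtain U where U: "open U" "N \<subseteq> U" "U - N \<in> lmeasurable" "emeasure lebesgue (U - N) < ennreal \<delta>"
      using sets_lebesgue_outer_open[OF negligible_imp_sets[OF N] \<delta>(1)] by blast
    have "measure lebesgue (U - N) < \<delta>"
      using U(3,4) \<delta>(1) by (simp add: emeasure_eq_measure2 ennreal_less_iff)
    moreover have eqU: "U = (U - N) \<union> N" using U by blast
    have "measure lebesgue ((U - N) \<union> N) = measure lebesgue (U - N)"
      using N unfolding negligible_iff_null_sets by (rule measure_Un_null_set[OF fmeasurableD[OF U(3)]])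
    ultimately have mU: "measure lebesgue U < \<delta>" using eqU by simp
    have "(U - N) \<union> N \<in> lmeasurable"
      by (rule fmeasurable.Un[OF U(3) negligible_imp_measurable[OF N]])
    then have lU: "U \<in> lmeasurable" using eqU by simp
    have "\<exists>d>0. \<forall>y\<in>{a..b}. \<bar>y - x\<bar> < d \<longrightarrow> \<bar>f y - f x - (y - x) * g x\<bar> \<le> c * \<bar>y - x\<bar>"
      if "x \<in> {a..b} - N" for x
      using deriv[OF that] c unfolding has_vector_derivative_def has_derivative_within_alt
      by (auto simp: norm_minus_commute)
    then obtain d where d: "\<And>x. x \<in> {a..b} - N \<Longrightarrow> d x > 0"
      "\<And>x y. x \<in> {a..b} - N \<Longrightarrow> y \<in> {a..b} \<Longrightarrow> \<bar>y - x\<bar> < d x \<Longrightarrow> \<bar>f y - f x - (y - x) * g x\<bar> \<le> c * \<bar>y - x\<bar>"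
      by metis
    \<comment> \<open>A tag in \<open>N\<close> forces its interval into the open set
      \<open>U\<close> of measure below \<open>\<delta>\<close>; any other tag in
      \<open>{a..b}\<close> forces its interval into the range of the linear approximation at that
      tag.\<close>
    define G where "G x = (if x \<in> N then U else if x \<in> {a..b} then ball x (d x) else UNIV)" for x
    have gauge: "gauge G"
      using U(1,2) d(1) unfolding gauge_def G_def by auto
    have sum_less: "norm ((\<Sum>(x, K)\<in>D. measure lborel K *\<^sub>R g0 x) - (f b - f a)) < e"
      if D: "D tagged_division_of {a..b}" "G fine D" for D
    proof -
      have fin: "finite D" using D by auto
      have K: "\<exists>u v. K = {u..v} \<and> u \<le> x \<and> x \<le> v \<and> a \<le> u \<and> v \<le> b \<and> K \<subseteq> G x" if xK: "(x, K) \<in> D" for x K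
      proof -
        obtain u v where "K = cbox u v" using tagged_division_ofD(4)[OF D(1) xK] by blast
        moreover have "x \<in> K" "K \<subseteq> {a..b}" using tagged_division_ofD(2,3)[OF D(1) that] by auto
        moreover have "K \<subseteq> G x" using D(2) that by (auto simp: fine_def)
        ultimately show ?thesis by auto
      qed
      \<comment> \<open>Degenerate intervals have zero increment and are left out. Distinct members
        of \<open>S\<close> then have disjoint nonempty interiors, which makes the map to pairs of
        end points injective.\<close>
      define S where "S = {(x, K) \<in> D. x \<in> N \<and> Inf K < Sup K}"
      define \<Delta> where "\<Delta> K = f (Sup K) - f (Inf K)" for K
      have finS: "finite S" using fin by (auto simp: S_def intro: finite_subset)
      have SD: "S \<subseteq> D" by (auto simp: S_def)
      have "\<bar>measure lborel K * g0 x - \<Delta> K\<bar> \<le> c * measure lborel K + (if (x, K) \<in> S then \<bar>\<Delta> K\<bar> else 0)"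
        if xK: "(x, K) \<in> D" for x K
      proof -
        obtain u v where uv: "K = {u..v}" "u \<le> x" "x \<le> v" "a \<le> u" "v \<le> b" "K \<subseteq> G x"
          using K[OF xK] by blast
        have K': "Inf K = u" "Sup K = v" "measure lborel K = v - u" using uv by auto
        have cK: "c * measure lborel K \<ge> 0" using c by simp
        show ?thesis
        proof (cases "x \<in> N")
          case True
          moreover have "u < v \<or> u = v" using uv(2,3) by auto
          ultimately show ?thesis using xK cK by (auto simp: S_def K' g0_def \<Delta>_def)
        next
          case False
          have x: "x \<in> {a..b} - N" using False uv by auto
          have "u \<in> G x" "v \<in> G x" using uv by auto
          then have "\<bar>u - x\<bar> < d x" "\<bar>v - x\<bar> < d x"
            using x by (auto simp: G_def dist_real_def)
          then have le: "\<bar>f u - f x - (u - x) * g x\<bar> \<le> c * \<bar>u - x\<bar>" "\<bar>f v - f x - (v - x) * g x\<bar> \<le> c * \<bar>v - x\<bar>"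
            using uv x by (intro d(2); simp)+
          \<comment> \<open>As the tag satisfies \<open>u \<le> x \<le> v\<close>, the two errors
            measured from \<open>x\<close> add up to at most \<open>c * (v - u)\<close>.\<close>
          have "(v - u) * g x - (f v - f u) =
              (f u - f x - (u - x) * g x) - (f v - f x - (v - x) * g x)"
            by (simp add: algebra_simps)
          also have "\<bar>\<dots>\<bar> \<le> c * \<bar>u - x\<bar> + c * \<bar>v - x\<bar>"
            by (rule order_trans[OF abs_triangle_ineq4 add_mono[OF le]])
          also have "\<dots> = c * (v - u)"
            using uv(2,3) by (simp add: algebra_simps)
          finally have "\<bar>(v - u) * g x - (f v - f u)\<bar> \<le> c * (v - u)" .
          then show ?thesis using False by (simp add: K' g0_def S_def \<Delta>_def)
        qed
      qed
      then have "(\<Sum>(x, K)\<in>D. \<bar>measure lborel K * g0 x - \<Delta> K\<bar>) \<le>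
          (\<Sum>(x, K)\<in>D. c * measure lborel K + (if (x, K) \<in> S then \<bar>\<Delta> K\<bar> else 0))"
        by (intro sum_mono) auto
      also have "\<dots> = c * (\<Sum>(x, K)\<in>D. measure lborel K) + (\<Sum>(x, K)\<in>S. \<bar>\<Delta> K\<bar>)"
      proof -
        have "(\<Sum>I\<in>D. if I \<in> S then \<bar>\<Delta> (snd I)\<bar> else 0) = (\<Sum>I\<in>S. \<bar>\<Delta> (snd I)\<bar>)"
          using SD fin by (simp add: sum.inter_restrict[symmetric] Int_absorb1)
        then show ?thesis
          by (simp add: sum.distrib sum_distrib_left case_prod_unfold)
      qed
      also have "(\<Sum>(x, K)\<in>D. measure lborel K) = b - a"
        using additive_content_tagged_division[of D a b] D(1) \<open>a \<le> b\<close> by (simp add: box_real)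
      also have "(\<Sum>(x, K)\<in>S. \<bar>\<Delta> K\<bar>) < e / 2"
      proof -
        define \<phi> where "\<phi> = (\<lambda>(x::real, K::real set). (Inf K, Sup K))"
        have disj: "{Inf K<..<Sup K} \<inter> {Inf K'<..<Sup K'} = {}"
          if "(x, K) \<in> S" "(x', K') \<in> S" "(x, K) \<noteq> (x', K')" for x K x' K'
        proof -
          have xK: "(x, K) \<in> D" "(x', K') \<in> D" using that SD by auto
          have "interior K \<inter> interior K' = {}"
            using tagged_division_ofD(5)[OF D(1) xK that(3)] .
          moreover obtain u v u' v' where "K = {u..v}" "u \<le> v" "K' = {u'..v'}" "u' \<le> v'"
            using K[OF xK(1)] K[OF xK(2)] by force
          ultimately show ?thesis by (simp add: interior_atLeastAtMost_real)
        qed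
        have ne: "{Inf K<..<Sup K} \<noteq> {}" if "(x, K) \<in> S" for x K
          using that by (auto simp: S_def)
        have inj: "inj_on \<phi> S"
        proof (rule inj_onI, clarify)
          fix x K x' K' assume S: "(x, K) \<in> S" "(x', K') \<in> S" and "\<phi> (x, K) = \<phi> (x', K')"
          then have "{Inf K<..<Sup K} = {Inf K'<..<Sup K'}" by (simp add: \<phi>_def)
          then show "x = x' \<and> K = K'" using disj[OF S] ne[OF S(1)] by blast
        qed
        have "nonoverlapping a b (\<phi> ` S)"
          unfolding nonoverlapping_def
        proof (intro conjI)
          show "finite (\<phi> ` S)" using finS by simp
          show "\<forall>(u, v)\<in>\<phi> ` S. a \<le> u \<and> u \<le> v \<and> v \<le> b"
            using K SD by (fastforce simp: \<phi>_def)
          show "disjoint_family_on (\<lambda>(u, v). {u<..<v}) (\<phi> ` S)"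
            unfolding disjoint_family_on_def
          proof (intro ballI impI)
            fix I J assume "I \<in> \<phi> ` S" "J \<in> \<phi> ` S" "I \<noteq> J"
            then obtain x K x' K' where S: "(x, K) \<in> S" "I = (Inf K, Sup K)" "(x', K') \<in> S" "J = (Inf K', Sup K')"
              by (auto simp: \<phi>_def)
            then have "(x, K) \<noteq> (x', K')" using \<open>I \<noteq> J\<close> by auto
            from disj[OF S(1,3) this]
            show "(case I of (u, v) \<Rightarrow> {u<..<v}) \<inter> (case J of (u, v) \<Rightarrow> {u<..<v}) = {}"
              using S by simp
          qed
        qed
        moreover have "(\<Sum>(u, v)\<in>\<phi> ` S. v - u) < \<delta>"
        proof -
          have "{u<..<v} \<subseteq> U" if uv: "(u, v) \<in> \<phi> ` S" for u v
          proof -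
            obtain x K where xK: "(x, K) \<in> S" "u = Inf K" "v = Sup K" using uv by (auto simp: \<phi>_def)
            then have "K \<subseteq> G x" "x \<in> N" using K[of x K] SD by (auto simp: S_def)
            moreover have "{u<..<v} \<subseteq> K" using xK SD K[of x K] by force
            ultimately show ?thesis by (auto simp: G_def)
          qed
          then have "(\<Sum>(u, v)\<in>\<phi> ` S. v - u) \<le> measure lebesgue U"
            using calculation lU by (intro nonoverlapping_sum_le_measure)
          then show ?thesis using mU by linarith
        qed
        ultimately have "(\<Sum>(u, v)\<in>\<phi> ` S. \<bar>f v - f u\<bar>) < e / 2" by (rule \<delta>(2))
        moreover have "(\<Sum>(u, v)\<in>\<phi> ` S. \<bar>f v - f u\<bar>) = (\<Sum>(x, K)\<in>S. \<bar>\<Delta> K\<bar>)"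
          unfolding sum.reindex[OF inj] by (intro sum.cong) (auto simp: \<phi>_def \<Delta>_def)
        ultimately show ?thesis by simp
      qed
      finally have "(\<Sum>(x, K)\<in>D. \<bar>measure lborel K * g0 x - \<Delta> K\<bar>) < e"
        using cba by simp
      moreover have "(\<Sum>(x, K)\<in>D. measure lborel K *\<^sub>R g0 x) - (f b - f a) = (\<Sum>(x, K)\<in>D. measure lborel K * g0 x - \<Delta> K)"
      proof -
        have "(\<Sum>(x, K)\<in>D. \<Delta> K) = f b - f a"
          unfolding \<Delta>_def by (rule additive_tagged_division_1[OF \<open>a \<le> b\<close> D(1)])
        then show ?thesis by (simp add: sum_subtractf case_prod_unfold)
      qed
      moreover have "\<bar>\<Sum>(x, K)\<in>D. measure lborel K * g0 x - \<Delta> K\<bar> \<le> (\<Sum>(x, K)\<in>D. \<bar>measure lborel K * g0 x - \<Delta> K\<bar>)"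
        using sum_abs[of "\<lambda>(x, K). measure lborel K * g0 x - \<Delta> K" D] by (simp add: case_prod_unfold)
      ultimately show ?thesis by simp
    qed
    show "\<exists>\<gamma>. gauge \<gamma> \<and> (\<forall>D. D tagged_division_of {a..b} \<and> \<gamma> fine D \<longrightarrow>
        norm ((\<Sum>(x, K)\<in>D. measure lborel K *\<^sub>R g0 x) - (f b - f a)) < e)"
      by (intro exI[of _ G] conjI allI impI gauge sum_less) auto
  qed
  then show ?thesis
    by (rule has_integral_spike[OF N, rotated]) (simp add: g0_def)
qed

text \<open>With the \<open>\<delta>\<close> belonging to \<open>\<epsilon> = 1\<close>, the
  variation is at most 1 on intervals shorter than \<open>\<delta>\<close>. There \<open>f\<close>
  is differentiable almost everywhere and its derivative integrates to the increments, whose bounded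
  variation gives absolute integrability. Bisection carries both facts to
  \<open>{a..b}\<close>.\<close>

lemma
  fixes f :: "real \<Rightarrow> real"
  assumes ac: "absolutely_continuous_fun_on a b f" and "a \<le> b"
  defines "f' \<equiv> \<lambda>x. vector_derivative f (at x)"
  shows absolutely_continuous_fun_on_differentiable_ae:
      "negligible {x \<in> {a..b}. \<not> f differentiable (at x)}" (is "negligible (?N a b)")
    and absolutely_continuous_fun_on_absolutely_integrable: "f' absolutely_integrable_on {a..b}"
    and absolutely_continuous_fun_on_integral: "(f' has_integral (f b - f a)) {a..b}"
proof -
  have hi: "(f' has_integral (f d - f c)) {c..d}"
    if "negligible (?N c d)" "a \<le> c" "c \<le> d" "d \<le> b" for c d
  proof (rule absolutely_continuous_fun_on_has_integral[OF _ that(3,1)])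
    show "absolutely_continuous_fun_on c d f"
      using absolutely_continuous_fun_on_subinterval ac that by blast
    show "(f has_vector_derivative f' x) (at x within {c..d})" if "x \<in> {c..d} - ?N c d" for x
      using that unfolding f'_def
      by (auto simp: vector_derivative_works intro: has_vector_derivative_at_within)
  qed
  obtain \<delta> where \<delta>: "\<delta> > 0"
    "\<And>D. nonoverlapping a b D \<Longrightarrow> (\<Sum>(u, v)\<in>D. v - u) < \<delta> \<Longrightarrow> (\<Sum>(u, v)\<in>D. \<bar>f v - f u\<bar>) < 1"
    using ac unfolding absolutely_continuous_fun_on_iff by (meson zero_less_one)
  \<comment> \<open>The Bolzano principle asks for all short intervals around a point, including
    those that stick out of \<open>{a..b}\<close>; the premise makes the property trivial for
    them.\<close>
  define P where "P c d \<longleftrightarrow> (a \<le> c \<and> d \<le> b \<longrightarrow> negligible (?N c d) \<and> f' absolutely_integrable_on {c..d})" for c d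
  have "P a b"
  proof (rule Bolzano[OF \<open>a \<le> b\<close>, of P])
    fix c d e assume trans: "P c d" "P d e" "c \<le> d" "d \<le> e"
    show "P c e"
      unfolding P_def
    proof
      assume "a \<le> c \<and> e \<le> b"
      then have *: "negligible (?N c d)" "f' absolutely_integrable_on {c..d}"
        "negligible (?N d e)" "f' absolutely_integrable_on {d..e}"
        using trans by (auto simp: P_def)
      have "?N c e \<subseteq> ?N c d \<union> ?N d e" by auto
      then have "negligible (?N c e)" by (rule negligible_subset[OF negligible_Un[OF *(1,3)]])
      moreover have "f' absolutely_integrable_on {c..e}"
        by (rule absolutely_integrable_on_combine[OF *(2,4) trans(3,4)])
      ultimately show "negligible (?N c e) \<and> f' absolutely_integrable_on {c..e}" by blast
    qed
  next
    fix x
    have "negligible (?N c d) \<and> f' absolutely_integrable_on {c..d}"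
      if cd: "a \<le> c" "d \<le> b" "c \<le> x" "x \<le> d" "d - c < \<delta>" for c d
    proof
      have bv: "(\<Sum>(u, v)\<in>D. \<bar>f v - f u\<bar>) \<le> 1" if D: "nonoverlapping c d D" for D
      proof -
        have "(\<Sum>(u, v)\<in>D. v - u) \<le> measure lebesgue {c..d}"
        proof (rule nonoverlapping_sum_le_measure[OF D])
          show "{u<..<v} \<subseteq> {c..d}" if "(u, v) \<in> D" for u v
            using D that by (auto simp: nonoverlapping_def)
        qed auto
        then have "(\<Sum>(u, v)\<in>D. v - u) < \<delta>" using cd by simp
        moreover have "nonoverlapping a b D"
          using nonoverlapping_mono[OF D] cd by blast
        ultimately show ?thesis using \<delta>(2) less_imp_le by blast
      qed
      then show neg: "negligible (?N c d)" by (rule bounded_variation_differentiable_ae)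
      have int: "(f' has_integral (f v - f u)) {u..v}" if "c \<le> u" "u \<le> v" "v \<le> d" for u v
      proof (rule hi)
        show "negligible (?N u v)"
          by (rule negligible_subset[OF neg]) (use that in auto)
      qed (use that cd in auto)
      \<comment> \<open>The integral of \<open>f'\<close> over a piece of a division is the
        increment of \<open>f\<close>, so the sum of norms is a variation sum and is at most
        1.\<close>
      have "f' absolutely_integrable_on cbox c d"
      proof (rule bounded_variation_absolutely_integrable_interval)
        show "f' integrable_on cbox c d"
          using int[of c d] cd by auto
        fix \<D> assume \<D>: "\<D> division_of cbox c d"
        define \<phi> where "\<phi> K = (Inf K, Sup K)" for K :: "real set"
        have K: "\<exists>u v. K = {u..v} \<and> c \<le> u \<and> u \<le> v \<and> v \<le> d" if KD: "K \<in> \<D>" for K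
        proof -
          obtain u v where "K = cbox u v" using division_ofD(4)[OF \<D> KD] by blast
          moreover have "K \<noteq> {}" "K \<subseteq> cbox c d" using division_ofD(2,3)[OF \<D> that] by auto
          ultimately show ?thesis by auto
        qed
        have inj: "inj_on \<phi> \<D>"
        proof (rule inj_onI)
          fix K K' assume KK: "K \<in> \<D>" "K' \<in> \<D>" "\<phi> K = \<phi> K'"
          then obtain u v u' v' where "K = {u..v}" "u \<le> v" "K' = {u'..v'}" "u' \<le> v'"
            using K[OF KK(1)] K[OF KK(2)] by force
          then show "K = K'" using KK(3) by (simp add: \<phi>_def)
        qed
        have "nonoverlapping c d (\<phi> ` \<D>)"
          unfolding nonoverlapping_def
        proof (intro conjI)
          show "finite (\<phi> ` \<D>)" using \<D> by blast
          show "\<forall>(u, v)\<in>\<phi> ` \<D>. c \<le> u \<and> u \<le> v \<and> v \<le> d"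
            using K by (fastforce simp: \<phi>_def)
          show "disjoint_family_on (\<lambda>(u, v). {u<..<v}) (\<phi> ` \<D>)"
            unfolding disjoint_family_on_def
          proof (intro ballI impI)
            fix I J assume "I \<in> \<phi> ` \<D>" "J \<in> \<phi> ` \<D>" "I \<noteq> J"
            then obtain K K' where KK: "K \<in> \<D>" "K' \<in> \<D>" "K \<noteq> K'" "I = \<phi> K" "J = \<phi> K'" by blast
            then have "interior K \<inter> interior K' = {}" using division_ofD(5)[OF \<D>] by blast
            moreover obtain u v u' v' where "K = {u..v}" "u \<le> v" "K' = {u'..v'}" "u' \<le> v'"
              using K[OF KK(1)] K[OF KK(2)] by force
            ultimately show "(case I of (u, v) \<Rightarrow> {u<..<v}) \<inter> (case J of (u, v) \<Rightarrow> {u<..<v}) = {}"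
              using KK by (simp add: interior_atLeastAtMost_real \<phi>_def)
          qed
        qed
        then have "(\<Sum>(u, v)\<in>\<phi> ` \<D>. \<bar>f v - f u\<bar>) \<le> 1" by (rule bv)
        moreover have "(\<Sum>(u, v)\<in>\<phi> ` \<D>. \<bar>f v - f u\<bar>) = (\<Sum>K\<in>\<D>. norm (integral K f'))"
          unfolding sum.reindex[OF inj]
        proof (intro sum.cong refl)
          fix K assume "K \<in> \<D>"
          then obtain u v where uv: "K = {u..v}" "c \<le> u" "u \<le> v" "v \<le> d" using K by blast
          then have "integral K f' = f v - f u" using int by (auto intro: integral_unique)
          then show "((\<lambda>(u, v). \<bar>f v - f u\<bar>) \<circ> \<phi>) K = norm (integral K f')"
            using uv by (simp add: \<phi>_def)
        qed
        ultimately show "(\<Sum>K\<in>\<D>. norm (integral K f')) \<le> 1" by simp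
      qed
      then show "f' absolutely_integrable_on {c..d}" by simp
    qed
    then show "\<exists>d>0. \<forall>a b. a \<le> x \<and> x \<le> b \<and> b - a < d \<longrightarrow> P a b"
      using \<delta>(1) unfolding P_def by (intro exI[of _ \<delta>]) blast
  qed
  then show *: "negligible (?N a b)" and "f' absolutely_integrable_on {a..b}" by (auto simp: P_def)
  show "(f' has_integral (f b - f a)) {a..b}" using hi * \<open>a \<le> b\<close> by blast
qed

section \<open>Continuity and sufficient conditions for absolute continuity\<close>

lemma absolutely_continuous_fun_on_continuous:
  assumes "absolutely_continuous_fun_on a b f"
  shows "continuous_on {a..b} f"
  unfolding continuous_on_iff
proof (intro ballI allI impI)
  fix x e :: real assume x: "x \<in> {a..b}" and "e > 0"
  then obtain \<delta> where \<delta>: "\<delta> > 0"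
    "\<And>D. nonoverlapping a b D \<Longrightarrow> (\<Sum>(u, v)\<in>D. v - u) < \<delta> \<Longrightarrow> (\<Sum>(u, v)\<in>D. \<bar>f v - f u\<bar>) < e"
    using assms unfolding absolutely_continuous_fun_on_iff by meson
  have "dist (f y) (f x) < e" if "y \<in> {a..b}" "dist y x < \<delta>" for y
  proof (cases "x \<le> y")
    case True
    then show ?thesis
      using \<delta>(2)[of "{(x, y)}"] x that
      by (auto simp: nonoverlapping_def disjoint_family_on_def dist_real_def)
  next
    case False
    then show ?thesis
      using \<delta>(2)[of "{(y, x)}"] x that
      by (auto simp: nonoverlapping_def disjoint_family_on_def dist_real_def)
  qed
  then show "\<exists>d>0. \<forall>y\<in>{a..b}. dist y x < d \<longrightarrow> dist (f y) (f x) < e"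
    using \<delta>(1) by blast
qed

text \<open>The smallest of the finitely many \<open>\<delta> i\<close> works for all
  \<open>f i\<close> at once. The main use is the composition of a curve with a function that is
  Lipschitz for the taxicab norm, where the \<open>f i\<close> are the coordinates of the
  curve.\<close>

lemma absolutely_continuous_fun_on_dominated:
  fixes f :: "'i \<Rightarrow> real \<Rightarrow> real"
  assumes "finite I" and ac: "\<And>i. i \<in> I \<Longrightarrow> absolutely_continuous_fun_on a b (f i)" and "C \<ge> 0"
    and le: "\<And>u v. a \<le> u \<Longrightarrow> u \<le> v \<Longrightarrow> v \<le> b \<Longrightarrow> \<bar>h v - h u\<bar> \<le> C * (\<Sum>i\<in>I. \<bar>f i v - f i u\<bar>)"
  shows "absolutely_continuous_fun_on a b h"
  unfolding absolutely_continuous_fun_on_iff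
proof (intro allI impI)
  fix e :: real assume e: "e > 0"
  \<comment> \<open>This gives \<open>C * card I * e' < e\<close>; the added ones avoid division by
    0 when \<open>C = 0\<close> or \<open>I\<close> is empty.\<close>
  define e' where "e' = e / ((C + 1) * (real (card I) + 1))"
  have e': "e' > 0" using e \<open>C \<ge> 0\<close> by (simp add: e'_def add_pos_nonneg)
  have "\<forall>i\<in>I. \<exists>\<delta>>0. \<forall>D. nonoverlapping a b D \<and> (\<Sum>(u, v)\<in>D. v - u) < \<delta> \<longrightarrow>
      (\<Sum>(u, v)\<in>D. \<bar>f i v - f i u\<bar>) < e'"
    using ac e' unfolding absolutely_continuous_fun_on_iff by blast
  then obtain \<delta> where \<delta>: "\<And>i. i \<in> I \<Longrightarrow> \<delta> i > 0"
    "\<And>i D. i \<in> I \<Longrightarrow> nonoverlapping a b D \<Longrightarrow> (\<Sum>(u, v)\<in>D. v - u) < \<delta> i \<Longrightarrow>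
      (\<Sum>(u, v)\<in>D. \<bar>f i v - f i u\<bar>) < e'"
    by metis
  define d where "d = Min (insert 1 (\<delta> ` I))"
  have d: "d > 0" using \<delta>(1) \<open>finite I\<close> by (simp add: d_def)
  have d_le: "d \<le> \<delta> i" if "i \<in> I" for i using that \<open>finite I\<close> by (simp add: d_def)
  have "(\<Sum>(u, v)\<in>D. \<bar>h v - h u\<bar>) < e" if D: "nonoverlapping a b D" "(\<Sum>(u, v)\<in>D. v - u) < d" for D
  proof -
    have "(\<Sum>(u, v)\<in>D. \<bar>h v - h u\<bar>) \<le> (\<Sum>(u, v)\<in>D. C * (\<Sum>i\<in>I. \<bar>f i v - f i u\<bar>))"
      using D le by (intro sum_mono) (auto simp: nonoverlapping_def)
    also have "\<dots> = C * (\<Sum>i\<in>I. \<Sum>(u, v)\<in>D. \<bar>f i v - f i u\<bar>)"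
      by (simp add: sum_distrib_left case_prod_unfold) (rule sum.swap)
    also have "\<dots> \<le> C * (\<Sum>i\<in>I. e')"
    proof (intro mult_left_mono[OF _ \<open>C \<ge> 0\<close>] sum_mono less_imp_le)
      show "(\<Sum>(u, v)\<in>D. \<bar>f i v - f i u\<bar>) < e'" if "i \<in> I" for i
        using \<delta>(2)[OF that D(1)] D(2) d_le[OF that] by linarith
    qed
    also have "\<dots> < (C + 1) * ((real (card I) + 1) * e')"
      using \<open>C \<ge> 0\<close> e' by (simp add: algebra_simps add_pos_nonneg)
    also have "\<dots> = e"
      using \<open>C \<ge> 0\<close> by (simp add: e'_def divide_simps)
    finally show ?thesis .
  qed
  then show "\<exists>\<delta>>0. \<forall>D. nonoverlapping a b D \<and> (\<Sum>(u, v)\<in>D. v - u) < \<delta> \<longrightarrow> (\<Sum>(u, v)\<in>D. \<bar>h v - h u\<bar>) < e"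
    using d by blast
qed

lemma lipschitz_imp_absolutely_continuous_fun_on:
  fixes h :: "real \<Rightarrow> real"
  assumes "C \<ge> 0" "\<And>u v. a \<le> u \<Longrightarrow> u \<le> v \<Longrightarrow> v \<le> b \<Longrightarrow> \<bar>h v - h u\<bar> \<le> C * (v - u)"
  shows "absolutely_continuous_fun_on a b h"
proof (rule absolutely_continuous_fun_on_dominated[of "{()}" _ _ "\<lambda>_ x. x" C])
  show "absolutely_continuous_fun_on a b (\<lambda>x. x)"
    unfolding absolutely_continuous_fun_on_iff
  proof (intro allI impI)
    fix e :: real assume "e > 0"
    moreover have "(\<Sum>(u, v)\<in>D. \<bar>v - u\<bar>) = (\<Sum>(u, v)\<in>D. v - u)" if "nonoverlapping a b D" for D
      using that by (intro sum.cong) (auto simp: nonoverlapping_def)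
    ultimately show "\<exists>\<delta>>0. \<forall>D. nonoverlapping a b D \<and> (\<Sum>(u, v)\<in>D. v - u) < \<delta> \<longrightarrow> (\<Sum>(u, v)\<in>D. \<bar>v - u\<bar>) < e"
      by (intro exI[of _ e]) auto
  qed
qed (use assms in auto)

section \<open>Curves in the taxicab ball\<close>

lemma taxicab_norm_nonneg: "taxicab_norm v \<ge> 0"
  by (simp add: taxicab_norm_def sum_nonneg)

lemma taxicab_norm_triangle: "taxicab_norm (v + w) \<le> taxicab_norm v + taxicab_norm w"
  unfolding taxicab_norm_def sum.distrib[symmetric] by (intro sum_mono) auto

lemma taxicab_norm_scaleR: "taxicab_norm (c *\<^sub>R v) = \<bar>c\<bar> * taxicab_norm v"
  by (simp add: taxicab_norm_def abs_mult sum_distrib_left)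

lemma continuous_on_taxicab_norm:
  "continuous_on S f \<Longrightarrow> continuous_on S (\<lambda>x. taxicab_norm (f x))"
  unfolding taxicab_norm_def by (intro continuous_intros)

lemma tendsto_taxicab_norm:
  "(f \<longlongrightarrow> l) F \<Longrightarrow> ((\<lambda>x. taxicab_norm (f x)) \<longlongrightarrow> taxicab_norm l) F"
  unfolding taxicab_norm_def by (intro tendsto_intros)

lemma has_vector_derivative_vec:
  fixes \<gamma> :: "real \<Rightarrow> real ^ 'n"
  assumes "\<And>i. ((\<lambda>t. \<gamma> t $ i) has_vector_derivative d i) F"
  shows "(\<gamma> has_vector_derivative (\<chi> i. d i)) F"
proof -
  have expand: "v = (\<Sum>i\<in>UNIV. (v $ i) *\<^sub>R axis i 1)" for v :: "real ^ 'n"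
    using basis_expansion[of v] by (simp add: scalar_mult_eq_scaleR)
  have "((\<lambda>t. \<Sum>i\<in>UNIV. (\<gamma> t $ i) *\<^sub>R axis i 1) has_vector_derivative (\<Sum>i\<in>UNIV. d i *\<^sub>R axis i (1::real))) F"
    by (intro has_vector_derivative_sum
        bounded_linear.has_vector_derivative[OF bounded_linear_scaleR_left] assms)
  moreover have "(\<Sum>i\<in>UNIV. d i *\<^sub>R axis i (1::real)) = (\<chi> i. d i)"
    using expand[of "\<chi> i. d i"] by simp
  moreover have "(\<lambda>t. \<Sum>i\<in>UNIV. (\<gamma> t $ i) *\<^sub>R axis i 1) = \<gamma>"
    by (rule ext) (rule expand[symmetric])
  ultimately show ?thesis by simp
qed

lemma curve_continuous:
  assumes "\<gamma> \<in> curves p q"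
  shows "continuous_on {0..1} \<gamma>"
proof -
  have "continuous_on {0..1} (\<lambda>t. \<chi> i. \<gamma> t $ i)"
    using assms by (intro continuous_on_vec_lambda absolutely_continuous_fun_on_continuous)
      (simp add: curves_def)
  then show ?thesis by simp
qed

lemma curve_norm_less_1:
  assumes "\<gamma> \<in> curves p q" "t \<in> {0..1}"
  shows "taxicab_norm (\<gamma> t) < 1"
proof -
  have "\<gamma> t \<in> taxicab_ball" using assms unfolding curves_def by blast
  then show ?thesis by (simp add: taxicab_ball_def)
qed

text \<open>By compactness a curve stays away from the boundary of the ball, so the factor
  \<open>1 / (1 - R\<^sup>2)\<close> bounds the density of the metric along the whole curve.\<close>

lemma curve_bounded_away:
  assumes "\<gamma> \<in> curves p q"
  obtains R where "R < 1" "\<And>t. t \<in> {0..1} \<Longrightarrow> taxicab_norm (\<gamma> t) \<le> R"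
proof -
  have "continuous_on {0..1} (\<lambda>t. taxicab_norm (\<gamma> t))"
    by (rule continuous_on_taxicab_norm[OF curve_continuous[OF assms]])
  then obtain s where "s \<in> {0..1}" "\<And>t. t \<in> {0..1} \<Longrightarrow> taxicab_norm (\<gamma> t) \<le> taxicab_norm (\<gamma> s)"
    using continuous_attains_sup[of "{0..1}" "\<lambda>t. taxicab_norm (\<gamma> t)"] by auto
  moreover have "taxicab_norm (\<gamma> s) < 1"
    by (rule curve_norm_less_1[OF assms \<open>s \<in> {0..1}\<close>])
  ultimately show thesis using that by blast
qed

section \<open>Speed and length of a curve\<close>

definition speed :: "(real \<Rightarrow> real ^ 'n) \<Rightarrow> real \<Rightarrow> real" where
  "speed \<gamma> t = taxicab_norm (vector_derivative \<gamma> (at t within {0..1})) / (1 - (taxicab_norm (\<gamma> t))\<^sup>2)"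

lemma conformal_factor_pos:
  assumes "taxicab_norm v < 1"
  shows "1 - (taxicab_norm v)\<^sup>2 > 0"
proof -
  have "\<bar>taxicab_norm v\<bar> < 1" using assms taxicab_norm_nonneg[of v] by simp
  then show ?thesis using abs_square_less_1[of "taxicab_norm v"] by simp
qed

lemma speed_nonneg:
  assumes "\<gamma> \<in> curves p q" "t \<in> {0..1}"
  shows "speed \<gamma> t \<ge> 0"
proof -
  show ?thesis
    unfolding speed_def
    by (intro divide_nonneg_pos taxicab_norm_nonneg conformal_factor_pos curve_norm_less_1[OF assms])
qed

lemma curve_vector_derivative:
  fixes \<gamma> :: "real \<Rightarrow> real ^ 'n"
  assumes "\<And>i. (\<lambda>t. \<gamma> t $ i) differentiable (at t)" and t: "t \<in> {0<..<1}"
  shows "(\<gamma> has_vector_derivative (\<chi> i. vector_derivative (\<lambda>t. \<gamma> t $ i) (at t))) (at t)"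
    and "vector_derivative \<gamma> (at t within {0..1}) = (\<chi> i. vector_derivative (\<lambda>t. \<gamma> t $ i) (at t))"
proof -
  show *: "(\<gamma> has_vector_derivative (\<chi> i. vector_derivative (\<lambda>t. \<gamma> t $ i) (at t))) (at t)"
    using assms by (intro has_vector_derivative_vec) (simp add: vector_derivative_works)
  show "vector_derivative \<gamma> (at t within {0..1}) = (\<chi> i. vector_derivative (\<lambda>t. \<gamma> t $ i) (at t))"
    using t by (intro vector_derivative_at_within_ivl[OF *]) simp_all
qed

lemma curve_differentiable_ae:
  fixes \<gamma> :: "real \<Rightarrow> real ^ 'n"
  assumes "\<gamma> \<in> curves p q"
  obtains N where "negligible N"
    "\<And>t i. t \<in> {0..1} - N \<Longrightarrow> t \<in> {0<..<1} \<and> (\<lambda>t. \<gamma> t $ i) differentiable (at t)"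
proof -
  \<comment> \<open>The points 0 and 1 are included so that elsewhere the derivative within
    \<open>{0..1}\<close> agrees with the two-sided derivative.\<close>
  define N where "N = {0, 1} \<union> (\<Union>i. {t \<in> {0..1}. \<not> (\<lambda>t. \<gamma> t $ i) differentiable (at t)})"
  have "negligible N"
    unfolding N_def
  proof (intro negligible_Un negligible_Union)
    show "negligible {0, 1::real}" by (simp add: negligible_finite)
    show "negligible T" if T: "T \<in> range (\<lambda>i. {t \<in> {0..1}. \<not> (\<lambda>t. \<gamma> t $ i) differentiable (at t)})" for T
    proof -
      obtain i where "T = {t \<in> {0..1}. \<not> (\<lambda>t. \<gamma> t $ i) differentiable (at t)}" using T by blast
      moreover have "absolutely_continuous_fun_on 0 1 (\<lambda>t. \<gamma> t $ i)" using assms by (simp add: curves_def)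
      ultimately show ?thesis using absolutely_continuous_fun_on_differentiable_ae by simp
    qed
  qed auto
  moreover have "t \<in> {0<..<1} \<and> (\<lambda>t. \<gamma> t $ i) differentiable (at t)" if "t \<in> {0..1} - N" for t i
    using that by (auto simp: N_def less_le)
  ultimately show thesis using that by blast
qed

text \<open>Almost everywhere the speed is the product of a bounded continuous density and the sum
  of the absolute values of the coordinate derivatives. Integrability excludes the default value 0
  of the Lebesgue integral, which would defeat lower bounds on lengths.\<close>

lemma speed_absolutely_integrable:
  fixes \<gamma> :: "real \<Rightarrow> real ^ 'n"
  assumes \<gamma>: "\<gamma> \<in> curves p q"
  shows "speed \<gamma> absolutely_integrable_on {0..1}"
proof -
  obtain N where N: "negligible N"
    "\<And>t i. t \<in> {0..1} - N \<Longrightarrow> t \<in> {0<..<1} \<and> (\<lambda>t. \<gamma> t $ i) differentiable (at t)"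
    using curve_differentiable_ae[OF \<gamma>] by blast
  define w where "w t = 1 / (1 - (taxicab_norm (\<gamma> t))\<^sup>2)" for t
  define l where "l t = (\<Sum>i\<in>UNIV. \<bar>vector_derivative (\<lambda>t. \<gamma> t $ i) (at t)\<bar>)" for t
  have "1 - (taxicab_norm (\<gamma> t))\<^sup>2 \<noteq> 0" if "t \<in> {0..1}" for t
    using conformal_factor_pos[OF curve_norm_less_1[OF \<gamma> that]] by simp
  then have w: "continuous_on {0..1} w"
    unfolding w_def
    by (intro continuous_intros continuous_on_taxicab_norm[OF curve_continuous[OF \<gamma>]]) auto
  have "(\<lambda>t. norm (vector_derivative (\<lambda>t. \<gamma> t $ i) (at t))) absolutely_integrable_on {0..1}" for i
    using \<gamma> by (intro set_integrable_norm absolutely_continuous_fun_on_absolutely_integrable)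
      (simp_all add: curves_def)
  then have l: "l absolutely_integrable_on {0..1}"
    unfolding l_def[abs_def] by (intro absolutely_integrable_sum) auto
  have "(\<lambda>t. w t * l t) absolutely_integrable_on {0..1}"
  proof (rule absolutely_integrable_bounded_measurable_product_real)
    show "w \<in> borel_measurable (lebesgue_on {0..1})"
      using w by (intro continuous_imp_measurable_on_sets_lebesgue) auto
    show "bounded (w ` {0..1})"
      using w by (intro compact_imp_bounded compact_continuous_image) auto
  qed (use l in auto)
  then show ?thesis
  proof (rule absolutely_integrable_spike[OF _ N(1)])
    fix t assume "t \<in> {0..1} - N"
    then show "speed \<gamma> t = w t * l t"
      using curve_vector_derivative(2)[of \<gamma> t] N(2)[of t]
      by (simp add: speed_def w_def l_def taxicab_norm_def)
  qed
qed

lemma curve_length_eq: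
  assumes "\<gamma> \<in> curves p q"
  shows "curve_length \<gamma> = integral {0..1} (speed \<gamma>)"
proof -
  have "curve_length \<gamma> = (LINT t:{0..1}|lebesgue. speed \<gamma> t)"
    unfolding curve_length_def speed_def ..
  then show ?thesis
    using set_lebesgue_integral_eq_integral(2)[OF speed_absolutely_integrable[OF assms]] by simp
qed

lemma curve_length_nonneg:
  assumes "\<gamma> \<in> curves p q"
  shows "curve_length \<gamma> \<ge> 0"
proof -
  have "speed \<gamma> integrable_on {0..1}"
    using set_lebesgue_integral_eq_integral(1)[OF speed_absolutely_integrable[OF assms]] .
  then have "0 \<le> integral {0..1} (speed \<gamma>)"
    using speed_nonneg[OF assms] by (rule integral_nonneg)
  then show ?thesis using curve_length_eq[OF assms] by simp
qed

lemma taxicab_dist_le: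
  assumes "\<gamma> \<in> curves p q"
  shows "taxicab_dist p q \<le> curve_length \<gamma>"
  unfolding taxicab_dist_def
  by (rule cINF_lower[OF bdd_belowI2[OF curve_length_nonneg] assms])

lemma lipschitz_curve:
  fixes \<gamma> :: "real \<Rightarrow> real ^ 'n"
  assumes "\<And>t. t \<in> {0..1} \<Longrightarrow> taxicab_norm (\<gamma> t) < 1"
    and lip: "\<And>u v i. 0 \<le> u \<Longrightarrow> u \<le> v \<Longrightarrow> v \<le> 1 \<Longrightarrow> \<bar>\<gamma> v $ i - \<gamma> u $ i\<bar> \<le> C i * (v - u)"
  shows "\<gamma> \<in> curves (\<gamma> 0) (\<gamma> 1)"
proof -
  have "C i \<ge> 0" for i using lip[of 0 1 i] abs_ge_zero[of "\<gamma> 1 $ i - \<gamma> 0 $ i"] by (simp del: abs_ge_zero)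
  then have "absolutely_continuous_fun_on 0 1 (\<lambda>t. \<gamma> t $ i)" for i
    using lip by (intro lipschitz_imp_absolutely_continuous_fun_on[of "C i"]) auto
  moreover have "\<gamma> ` {0..1} \<subseteq> taxicab_ball" using assms(1) by (auto simp: taxicab_ball_def)
  ultimately show ?thesis by (simp add: curves_def)
qed

text \<open>Along the segment the norm is bounded by a convex combination of two numbers below 1. A
  nonempty set of curves is what allows lower bounds on lengths to pass to the real infimum.\<close>

lemma curves_nonempty:
  fixes p q :: "real ^ 'n"
  assumes "p \<in> taxicab_ball" "q \<in> taxicab_ball"
  shows "curves p q \<noteq> {}"
proof -
  define \<gamma> where "\<gamma> t = (1 - t) *\<^sub>R p + t *\<^sub>R q" for t :: real
  have "\<gamma> \<in> curves (\<gamma> 0) (\<gamma> 1)"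
  proof (rule lipschitz_curve[where C = "\<lambda>i. \<bar>q $ i - p $ i\<bar>"])
    fix t :: real assume t: "t \<in> {0..1}"
    have "taxicab_norm (\<gamma> t) \<le> (1 - t) * taxicab_norm p + t * taxicab_norm q"
      using taxicab_norm_triangle[of "(1 - t) *\<^sub>R p" "t *\<^sub>R q"] t
      by (simp add: \<gamma>_def taxicab_norm_scaleR)
    also have "\<dots> < 1"
      using assms t by (intro convex_bound_lt) (auto simp: taxicab_ball_def)
    finally show "taxicab_norm (\<gamma> t) < 1" .
  next
    fix u v :: real and i assume "u \<le> v"
    have "\<gamma> v $ i - \<gamma> u $ i = (q $ i - p $ i) * (v - u)"
      by (simp add: \<gamma>_def algebra_simps)
    then show "\<bar>\<gamma> v $ i - \<gamma> u $ i\<bar> \<le> \<bar>q $ i - p $ i\<bar> * (v - u)"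
      using \<open>u \<le> v\<close> by (simp add: abs_mult)
  qed
  then show ?thesis by (auto simp: \<gamma>_def)
qed

text \<open>On small pieces of the curve near \<open>\<gamma> t\<close> the Lipschitz factor of
  \<open>\<Phi>\<close> approaches the density of the metric at \<open>\<gamma> t\<close>. So the
  derivative of \<open>\<Phi>\<close> along the curve is at most the speed almost everywhere, and
  integrating gives the claim because the composition is absolutely continuous.\<close>

lemma calibration_le_curve_length:
  fixes \<Phi> :: "real ^ 'n \<Rightarrow> real"
  assumes \<Phi>: "\<And>v w R. R < 1 \<Longrightarrow> taxicab_norm v \<le> R \<Longrightarrow> taxicab_norm w \<le> R \<Longrightarrow>
      \<bar>\<Phi> w - \<Phi> v\<bar> \<le> taxicab_norm (w - v) / (1 - R\<^sup>2)"
    and \<gamma>: "\<gamma> \<in> curves p q"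
  shows "\<bar>\<Phi> q - \<Phi> p\<bar> \<le> curve_length \<gamma>"
proof -
  define h where "h t = \<Phi> (\<gamma> t)" for t
  define h' where "h' t = vector_derivative h (at t)" for t
  obtain R where R: "R < 1" "\<And>t. t \<in> {0..1} \<Longrightarrow> taxicab_norm (\<gamma> t) \<le> R"
    using curve_bounded_away[OF \<gamma>] by blast
  have "R \<ge> 0" using R(2)[of 0] taxicab_norm_nonneg[of "\<gamma> 0"] by simp
  then have R2: "1 - R\<^sup>2 > 0" using R(1) by (simp add: abs_square_less_1)
  \<comment> \<open>Since \<open>R\<close> bounds the norm along the whole curve, one Lipschitz
    constant controls the increments of \<open>h\<close> by those of the coordinates.\<close>
  have ac: "absolutely_continuous_fun_on 0 1 h"
  proof (rule absolutely_continuous_fun_on_dominated[where I = UNIV and f = "\<lambda>i t. \<gamma> t $ i" and C = "1 / (1 - R\<^sup>2)"])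
    show "\<bar>h v - h u\<bar> \<le> 1 / (1 - R\<^sup>2) * (\<Sum>i\<in>UNIV. \<bar>\<gamma> v $ i - \<gamma> u $ i\<bar>)" if "0 \<le> u" "u \<le> v" "v \<le> 1" for u v
      using \<Phi>[of R "\<gamma> u" "\<gamma> v"] R that by (simp add: h_def taxicab_norm_def)
  qed (use \<gamma> R2 in \<open>auto simp: curves_def\<close>)
  obtain N where N: "negligible N"
    "\<And>t i. t \<in> {0..1} - N \<Longrightarrow> t \<in> {0<..<1} \<and> (\<lambda>t. \<gamma> t $ i) differentiable (at t)"
    using curve_differentiable_ae[OF \<gamma>] by blast
  define M where "M = N \<union> {t \<in> {0..1}. \<not> h differentiable (at t)}"
  have M: "negligible M"
    unfolding M_def using N(1) absolutely_continuous_fun_on_differentiable_ae[OF ac] by (simp add: negligible_Un)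
  have le: "\<bar>h' t\<bar> \<le> speed \<gamma> t" if t: "t \<in> {0..1} - M" for t
  proof -
    have t01: "t \<in> {0<..<1}" and diff: "(\<lambda>t. \<gamma> t $ i) differentiable (at t)" for i
      using N(2)[of t] t by (auto simp: M_def)
    define D where "D = vector_derivative \<gamma> (at t within {0..1})"
    have D: "(\<gamma> has_vector_derivative D) (at t)"
      using curve_vector_derivative[OF diff t01] by (simp add: D_def)
    have "h differentiable (at t)" using t by (auto simp: M_def)
    then have "(h has_vector_derivative h' t) (at t)"
      by (simp add: h'_def vector_derivative_works)
    then have "((\<lambda>y. (h y - h t) / (y - t)) \<longlongrightarrow> h' t) (at t)"
      by (simp add: has_real_derivative_iff_has_vector_derivative[symmetric] has_field_derivative_iff)
    then have lim1: "((\<lambda>y. \<bar>(h y - h t) / (y - t)\<bar>) \<longlongrightarrow> \<bar>h' t\<bar>) (at t)"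
      by (rule tendsto_rabs)
    have lim\<gamma>: "(\<gamma> \<longlongrightarrow> \<gamma> t) (at t)"
      using D has_vector_derivative_continuous continuous_within by blast
    have lim_quot: "((\<lambda>y. (1 / (y - t)) *\<^sub>R (\<gamma> y - \<gamma> t)) \<longlongrightarrow> D) (at t)"
    proof (rule vec_tendstoI)
      fix i
      have "((\<lambda>t. \<gamma> t $ i) has_vector_derivative D $ i) (at t)"
        using diff[of i] curve_vector_derivative(2)[OF diff t01]
        by (simp add: D_def vector_derivative_works)
      then show "((\<lambda>y. ((1 / (y - t)) *\<^sub>R (\<gamma> y - \<gamma> t)) $ i) \<longlongrightarrow> D $ i) (at t)"
        by (simp add: has_real_derivative_iff_has_vector_derivative[symmetric] has_field_derivative_iff)
    qed
    \<comment> \<open>The larger of the two norms is the best admissible radius for the pair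
      \<open>\<gamma> t\<close>, \<open>\<gamma> y\<close>. It tends to the norm at
      \<open>t\<close>, so the bound on the difference quotient tends to the speed.\<close>
    define m where "m y = max (taxicab_norm (\<gamma> y)) (taxicab_norm (\<gamma> t))" for y
    have "(m \<longlongrightarrow> max (taxicab_norm (\<gamma> t)) (taxicab_norm (\<gamma> t))) (at t)"
      unfolding m_def[abs_def] by (intro tendsto_max tendsto_taxicab_norm lim\<gamma> tendsto_const)
    then have lim_m: "(m \<longlongrightarrow> taxicab_norm (\<gamma> t)) (at t)" by simp
    have \<gamma>t: "taxicab_norm (\<gamma> t) < 1" using curve_norm_less_1[OF \<gamma>, of t] t by blast
    then have pos: "1 - (taxicab_norm (\<gamma> t))\<^sup>2 > 0" by (rule conformal_factor_pos)
    have lim2: "((\<lambda>y. taxicab_norm ((1 / (y - t)) *\<^sub>R (\<gamma> y - \<gamma> t)) / (1 - (m y)\<^sup>2)) \<longlongrightarrow> speed \<gamma> t) (at t)"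
      unfolding speed_def D_def[symmetric] using pos
      by (intro tendsto_divide tendsto_taxicab_norm lim_quot tendsto_diff tendsto_const tendsto_power lim_m) auto
    have ev: "eventually (\<lambda>y. y \<in> {0<..<1} - {t}) (at t)"
      using t01 eventually_at_in_open[of "{0<..<1}" t] by simp
    have "eventually (\<lambda>y. \<bar>(h y - h t) / (y - t)\<bar> \<le>
        taxicab_norm ((1 / (y - t)) *\<^sub>R (\<gamma> y - \<gamma> t)) / (1 - (m y)\<^sup>2)) (at t)"
      using ev
    proof eventually_elim
      case (elim y)
      have "taxicab_norm (\<gamma> y) < 1" using curve_norm_less_1[OF \<gamma>, of y] elim by simp
      then have "m y < 1" using \<gamma>t by (simp add: m_def)
      then have "\<bar>h y - h t\<bar> \<le> taxicab_norm (\<gamma> y - \<gamma> t) / (1 - (m y)\<^sup>2)"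
        unfolding h_def by (rule \<Phi>) (auto simp: m_def)
      then have "\<bar>h y - h t\<bar> / \<bar>y - t\<bar> \<le> taxicab_norm (\<gamma> y - \<gamma> t) / (1 - (m y)\<^sup>2) / \<bar>y - t\<bar>"
        by (rule divide_right_mono) simp
      then show ?case
        by (simp add: taxicab_norm_scaleR abs_divide mult.commute)
    qed
    then show ?thesis
      by (intro tendsto_le[OF _ lim2 lim1]) auto
  qed
  \<comment> \<open>The comparison of integrals asks for a bound at every point, so the derivative
    is replaced by 0 on the null set \<open>M\<close>.\<close>
  define k where "k t = (if t \<in> M then 0 else h' t)" for t
  have "(h' has_integral (h 1 - h 0)) {0..1}"
    unfolding h'_def by (rule absolutely_continuous_fun_on_integral[OF ac]) simp
  then have k: "(k has_integral (h 1 - h 0)) {0..1}"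
    by (rule has_integral_spike[OF M, rotated]) (simp add: k_def)
  have "norm (integral {0..1} k) \<le> integral {0..1} (speed \<gamma>)"
  proof (rule integral_norm_bound_integral)
    show "k integrable_on {0..1}" using k by blast
    show "speed \<gamma> integrable_on {0..1}"
      using set_lebesgue_integral_eq_integral(1)[OF speed_absolutely_integrable[OF \<gamma>]] .
    show "norm (k t) \<le> speed \<gamma> t" if "t \<in> {0..1}" for t
      using le[of t] that speed_nonneg[OF \<gamma> that] by (auto simp: k_def)
  qed
  moreover have "integral {0..1} k = \<Phi> q - \<Phi> p"
    using integral_unique[OF k] \<gamma> by (simp add: h_def curves_def)
  ultimately show ?thesis by (simp add: curve_length_eq[OF \<gamma>])
qed

lemma calibration_le_taxicab_dist:
  fixes \<Phi> :: "real ^ 'n \<Rightarrow> real"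
  assumes "\<And>v w R. R < 1 \<Longrightarrow> taxicab_norm v \<le> R \<Longrightarrow> taxicab_norm w \<le> R \<Longrightarrow>
      \<bar>\<Phi> w - \<Phi> v\<bar> \<le> taxicab_norm (w - v) / (1 - R\<^sup>2)"
    and "p \<in> taxicab_ball" "q \<in> taxicab_ball"
  shows "\<bar>\<Phi> q - \<Phi> p\<bar> \<le> taxicab_dist p q"
  unfolding taxicab_dist_def
  using curves_nonempty[OF assms(2,3)] calibration_le_curve_length[OF assms(1)]
  by (intro cINF_greatest)

section \<open>Calibrations and geodesics\<close>

text \<open>Mean value theorem: the derivative \<open>1 / (1 - z\<^sup>2)\<close> of
  \<open>artanh\<close> increases on \<open>[0, 1)\<close>. As it is also the density of the metric,
  \<open>artanh\<close> of the norm measures length along rays.\<close>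

lemma artanh_diff_le:
  fixes x y R :: real
  assumes "0 \<le> x" "x \<le> y" "y \<le> R" "R < 1"
  shows "artanh x \<le> artanh y" "artanh y - artanh x \<le> (y - x) / (1 - R\<^sup>2)"
proof -
  have "artanh x \<le> artanh y \<and> artanh y - artanh x \<le> (y - x) / (1 - R\<^sup>2)"
  proof (cases "x = y")
    case False
    then have "x < y" using assms by simp
    have "(artanh has_real_derivative 1 / (1 - z\<^sup>2)) (at z)" if "x \<le> z" "z \<le> y" for z
      using assms that by (intro artanh_real_has_field_derivative) auto
    then obtain z where z: "x < z" "z < y" "artanh y - artanh x = (y - x) * (1 / (1 - z\<^sup>2))"
      using MVT2[OF \<open>x < y\<close>, of artanh "\<lambda>z. 1 / (1 - z\<^sup>2)"] by blast
    have "z\<^sup>2 \<le> R\<^sup>2" using z assms by (intro power_mono) auto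
    moreover have "R\<^sup>2 < 1" using assms abs_square_less_1[of R] by simp
    ultimately have "0 \<le> 1 / (1 - z\<^sup>2)" "1 / (1 - z\<^sup>2) \<le> 1 / (1 - R\<^sup>2)"
      by (auto intro!: divide_left_mono)
    then have "0 \<le> (y - x) * (1 / (1 - z\<^sup>2))" "(y - x) * (1 / (1 - z\<^sup>2)) \<le> (y - x) * (1 / (1 - R\<^sup>2))"
      using \<open>x < y\<close> by (auto intro!: mult_left_mono mult_nonneg_nonneg simp del: times_divide_eq_right)
    then show ?thesis using z(3) by simp
  qed simp
  then show "artanh x \<le> artanh y" "artanh y - artanh x \<le> (y - x) / (1 - R\<^sup>2)" by auto
qed

lemma artanh_affine_deriv:
  fixes m k t :: real
  assumes "\<bar>m + k * t\<bar> < 1"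
  shows "((\<lambda>t. artanh (m + k * t)) has_field_derivative 1 / (1 - (m + k * t)\<^sup>2) * k) (at t)"
proof (rule DERIV_chain2[where f = artanh and g = "\<lambda>t. m + k * t"])
  show "(artanh has_field_derivative 1 / (1 - (m + k * t)\<^sup>2)) (at (m + k * t))"
    using assms by (rule artanh_real_has_field_derivative)
qed (auto intro!: derivative_eq_intros)

text \<open>The derivative of \<open>artanh\<close> is increasing on \<open>[0, 1)\<close>, so
  increments over a fixed step grow under a shift by \<open>s\<close>. The weak inequality gives
  convexity, the strict one gives strict superadditivity.\<close>

lemma artanh_increment_deriv:
  fixes c c' s :: real
  assumes "0 \<le> c" "c \<le> c'" "0 \<le> s" "c' + s < 1"
  shows "((\<lambda>s. artanh (c' + s) - artanh (c + s)) has_field_derivative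
      (1 / (1 - (c' + s)\<^sup>2) - 1 / (1 - (c + s)\<^sup>2))) (at s)"
    and "1 / (1 - (c + s)\<^sup>2) \<le> 1 / (1 - (c' + s)\<^sup>2)"
    and "c < c' \<Longrightarrow> 1 / (1 - (c + s)\<^sup>2) < 1 / (1 - (c' + s)\<^sup>2)"
proof -
  show "((\<lambda>s. artanh (c' + s) - artanh (c + s)) has_field_derivative
      (1 / (1 - (c' + s)\<^sup>2) - 1 / (1 - (c + s)\<^sup>2))) (at s)"
    using DERIV_diff[OF artanh_affine_deriv[of c' 1 s] artanh_affine_deriv[of c 1 s]] assms by simp
  have *: "(c' + s)\<^sup>2 < 1" using assms abs_square_less_1[of "c' + s"] by simp
  have "(c + s)\<^sup>2 \<le> (c' + s)\<^sup>2" using assms by (intro power_mono) auto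
  then show "1 / (1 - (c + s)\<^sup>2) \<le> 1 / (1 - (c' + s)\<^sup>2)"
    using * by (intro divide_left_mono mult_pos_pos) auto
  show "1 / (1 - (c + s)\<^sup>2) < 1 / (1 - (c' + s)\<^sup>2)" if "c < c'"
  proof -
    have "(c + s)\<^sup>2 < (c' + s)\<^sup>2" using assms that by (intro power_strict_mono) auto
    then show ?thesis using * by (intro divide_strict_left_mono mult_pos_pos) auto
  qed
qed

lemma artanh_convex:
  fixes c c' s :: real
  assumes "0 \<le> c" "c \<le> c'" "0 \<le> s" "c' + s < 1"
  shows "artanh c' - artanh c \<le> artanh (c' + s) - artanh (c + s)"
proof -
  have "(\<lambda>s. artanh (c' + s) - artanh (c + s)) 0 \<le> (\<lambda>s. artanh (c' + s) - artanh (c + s)) s"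
  proof (rule DERIV_nonneg_imp_nondecreasing[OF assms(3)])
    fix t assume "0 \<le> t" "t \<le> s"
    then show "\<exists>y. ((\<lambda>s. artanh (c' + s) - artanh (c + s)) has_field_derivative y) (at t) \<and> 0 \<le> y"
      using artanh_increment_deriv(1,2)[of c c' t] assms by force
  qed
  then show ?thesis by simp
qed

lemma artanh_superadditive:
  fixes x y :: real
  assumes "0 < x" "0 < y" "x + y < 1"
  shows "artanh x + artanh y < artanh (x + y)"
proof -
  have "(\<lambda>s. artanh (x + s) - artanh (0 + s)) 0 < (\<lambda>s. artanh (x + s) - artanh (0 + s)) y"
  proof (rule DERIV_pos_imp_increasing[OF assms(2)])
    fix t assume "0 \<le> t" "t \<le> y"
    then show "\<exists>d. ((\<lambda>s. artanh (x + s) - artanh (0 + s)) has_field_derivative d) (at t) \<and> 0 < d"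
      using artanh_increment_deriv(1,3)[of 0 x t] assms by force
  qed
  then show ?thesis by simp
qed

text \<open>When \<open>c\<close> rises to \<open>c'\<close>, the first summand rises by some
  \<open>A\<close> and \<open>artanh c\<close> by some \<open>C\<close> with
  \<open>0 \<le> C \<le> A\<close> by convexity. So \<open>\<bar>A - 2 * C\<bar> \<le> A\<close>:
  the factor 2 can reverse the change but not enlarge it.\<close>

lemma artanh_calibration:
  fixes c s c' s' R :: real
  assumes "0 \<le> c" "0 \<le> s" "0 \<le> c'" "0 \<le> s'" "c + s \<le> R" "c' + s' \<le> R" "R < 1"
  shows "\<bar>(artanh (c' + s') - 2 * artanh c') - (artanh (c + s) - 2 * artanh c)\<bar>
    \<le> (\<bar>c' - c\<bar> + \<bar>s' - s\<bar>) / (1 - R\<^sup>2)"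
  using assms
proof (induction c c' arbitrary: s s' rule: linorder_wlog)
  case (sym c c')
  from sym(1)[OF sym(4,5,2,3,7,6,8)] show ?case
    by (simp add: abs_minus_commute)
next
  case (le c c')
  \<comment> \<open>The passage from \<open>(c, s)\<close> to \<open>(c', s')\<close> goes through
    \<open>(c, s')\<close>, whose sum stays at most \<open>R\<close> because
    \<open>c \<le> c'\<close>.\<close>
  have ss: "\<bar>artanh (c + s') - artanh (c + s)\<bar> \<le> \<bar>s' - s\<bar> / (1 - R\<^sup>2)"
  proof (cases "s \<le> s'")
    case True
    then show ?thesis using artanh_diff_le[of "c + s" "c + s'" R] le by simp
  next
    case False
    then show ?thesis using artanh_diff_le[of "c + s'" "c + s" R] le by simp
  qed
  have 1: "artanh c' - artanh c \<le> artanh (c' + s') - artanh (c + s')"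
    using le by (intro artanh_convex) auto
  have 2: "artanh c \<le> artanh c'" using artanh_diff_le(1)[of c c' R] le by simp
  have 3: "artanh (c' + s') - artanh (c + s') \<le> (c' - c) / (1 - R\<^sup>2)"
    using artanh_diff_le(2)[of "c + s'" "c' + s'" R] le by simp
  have "(\<bar>c' - c\<bar> + \<bar>s' - s\<bar>) / (1 - R\<^sup>2) = (c' - c) / (1 - R\<^sup>2) + \<bar>s' - s\<bar> / (1 - R\<^sup>2)"
    using le(1) by (simp add: add_divide_distrib)
  then show ?case using ss 1 2 3 by linarith
qed

text \<open>For \<open>a \<ge> 0\<close> this is the norm of the meet of \<open>a\<close> with the positive part of \<open>w\<close>.\<close>

definition meet_norm :: "real ^ 'n \<Rightarrow> real ^ 'n \<Rightarrow> real" where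
  "meet_norm a w = (\<Sum>k\<in>UNIV. max 0 (min (w $ k) (a $ k)))"

text \<open>For nonnegative \<open>a\<close> and \<open>w\<close> in the ball,
  \<open>potential a w - potential a a\<close> is the length of the path that descends from
  \<open>a\<close> to its meet with \<open>w\<close> and climbs to \<open>w\<close>. This is why the
  potential detects such paths as shortest.\<close>

definition potential :: "real ^ 'n \<Rightarrow> real ^ 'n \<Rightarrow> real" where
  "potential a w = artanh (taxicab_norm w) - 2 * artanh (meet_norm a w)"

section \<open>Potentials as lower bounds for the distance\<close>

lemma meet_norm_nonneg: "0 \<le> meet_norm a w"
  by (simp add: meet_norm_def sum_nonneg)

lemma meet_norm_le: "meet_norm a w \<le> taxicab_norm w"
  unfolding meet_norm_def taxicab_norm_def by (intro sum_mono) auto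

text \<open>As a coordinate \<open>w $ k\<close> varies, the meet changes only between 0 and
  \<open>a $ k\<close>, and the remainder of the norm changes only outside this range, each with
  slope 1 in absolute value. The two changes therefore share the increment of the
  coordinate.\<close>

lemma meet_norm_split:
  assumes "\<And>k. a $ k \<ge> 0"
  shows "\<bar>meet_norm a w - meet_norm a v\<bar>
      + \<bar>(taxicab_norm w - meet_norm a w) - (taxicab_norm v - meet_norm a v)\<bar> \<le> taxicab_norm (w - v)"
proof -
  define m where "m w k = max 0 (min (w $ k) (a $ k))" for w k
  have *: "\<bar>m w k - m v k\<bar> + \<bar>(\<bar>w $ k\<bar> - m w k) - (\<bar>v $ k\<bar> - m v k)\<bar> \<le> \<bar>w $ k - v $ k\<bar>" for k
    using assms[of k] unfolding m_def by (auto simp: max_def min_def abs_if)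
  have 1: "meet_norm a w - meet_norm a v = (\<Sum>k\<in>UNIV. m w k - m v k)"
    by (simp add: meet_norm_def m_def sum_subtractf)
  have 2: "(taxicab_norm w - meet_norm a w) - (taxicab_norm v - meet_norm a v) =
      (\<Sum>k\<in>UNIV. (\<bar>w $ k\<bar> - m w k) - (\<bar>v $ k\<bar> - m v k))"
    by (simp add: meet_norm_def taxicab_norm_def m_def sum_subtractf)
  have "\<bar>meet_norm a w - meet_norm a v\<bar> \<le> (\<Sum>k\<in>UNIV. \<bar>m w k - m v k\<bar>)"
    "\<bar>(taxicab_norm w - meet_norm a w) - (taxicab_norm v - meet_norm a v)\<bar> \<le>
      (\<Sum>k\<in>UNIV. \<bar>(\<bar>w $ k\<bar> - m w k) - (\<bar>v $ k\<bar> - m v k)\<bar>)"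
    unfolding 1 2 by (rule sum_abs)+
  moreover have "(\<Sum>k\<in>UNIV. \<bar>m w k - m v k\<bar>) + (\<Sum>k\<in>UNIV. \<bar>(\<bar>w $ k\<bar> - m w k) - (\<bar>v $ k\<bar> - m v k)\<bar>)
      \<le> taxicab_norm (w - v)"
    unfolding taxicab_norm_def sum.distrib[symmetric] by (intro sum_mono) (use * in auto)
  ultimately show ?thesis by linarith
qed

lemma potential_le_taxicab_dist:
  fixes a :: "real ^ 'n"
  assumes a: "\<And>k. a $ k \<ge> 0" and "p \<in> taxicab_ball" "q \<in> taxicab_ball"
  shows "\<bar>potential a q - potential a p\<bar> \<le> taxicab_dist p q"
proof (rule calibration_le_taxicab_dist[OF _ assms(2,3)])
  fix v w :: "real ^ 'n" and R assume R: "R < 1" "taxicab_norm v \<le> R" "taxicab_norm w \<le> R"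
  have "0 \<le> R" using R(2) taxicab_norm_nonneg[of v] by linarith
  then have pos: "1 - R\<^sup>2 > 0" using R(1) abs_square_less_1[of R] by simp
  have "\<bar>potential a w - potential a v\<bar> \<le> (\<bar>meet_norm a w - meet_norm a v\<bar>
      + \<bar>(taxicab_norm w - meet_norm a w) - (taxicab_norm v - meet_norm a v)\<bar>) / (1 - R\<^sup>2)"
    using artanh_calibration[of "meet_norm a v" "taxicab_norm v - meet_norm a v"
        "meet_norm a w" "taxicab_norm w - meet_norm a w" R] R
    by (simp add: potential_def meet_norm_nonneg meet_norm_le)
  also have "\<dots> \<le> taxicab_norm (w - v) / (1 - R\<^sup>2)"
    using meet_norm_split[OF a, of w v] pos by (intro divide_right_mono) auto
  finally show "\<bar>potential a w - potential a v\<bar> \<le> taxicab_norm (w - v) / (1 - R\<^sup>2)" .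
qed

text \<open>On such a piece the speed is the derivative of
  \<open>\<epsilon> * artanh (m + k * t)\<close>. The factor \<open>\<epsilon>\<close> is 1 or -1 in
  the applications, according to whether the norm rises or falls. Derivatives are taken only in the
  interior, since the curves have a corner at the end of a piece.\<close>

lemma speed_has_integral_affine:
  assumes cd: "0 \<le> c" "c < d" "d \<le> 1"
    and deriv: "\<And>t. t \<in> {c<..<d} \<Longrightarrow> (\<gamma> has_vector_derivative w) (at t)"
    and norm: "\<And>t. t \<in> {c..d} \<Longrightarrow> taxicab_norm (\<gamma> t) = m + k * t"
    and less: "\<And>t. t \<in> {c..d} \<Longrightarrow> m + k * t < 1"
    and w: "taxicab_norm w = \<epsilon> * k"
  shows "(speed \<gamma> has_integral \<epsilon> * (artanh (m + k * d) - artanh (m + k * c))) {c..d}"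
proof -
  have bound: "\<bar>m + k * t\<bar> < 1" if "t \<in> {c..d}" for t
    using norm[OF that] less[OF that] taxicab_norm_nonneg[of "\<gamma> t"] by simp
  have "(speed \<gamma> has_integral (\<lambda>t. \<epsilon> * artanh (m + k * t)) d - (\<lambda>t. \<epsilon> * artanh (m + k * t)) c) {c..d}"
  proof (rule fundamental_theorem_of_calculus_interior)
    show "continuous_on {c..d} (\<lambda>t. \<epsilon> * artanh (m + k * t))"
      using bound less by (intro continuous_intros) (force simp: abs_less_iff)
    fix t assume t: "t \<in> {c<..<d}"
    have "vector_derivative \<gamma> (at t within {0..1}) = w"
      using deriv[OF t] t cd by (intro vector_derivative_at_within_ivl) auto
    then have "speed \<gamma> t = \<epsilon> * (1 / (1 - (m + k * t)\<^sup>2) * k)"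
      using norm[of t] t w by (simp add: speed_def)
    moreover have "((\<lambda>t. \<epsilon> * artanh (m + k * t)) has_field_derivative \<epsilon> * (1 / (1 - (m + k * t)\<^sup>2) * k)) (at t)"
      using bound[of t] t by (intro DERIV_cmult artanh_affine_deriv) simp
    ultimately show "((\<lambda>t. \<epsilon> * artanh (m + k * t)) has_vector_derivative speed \<gamma> t) (at t)"
      by (simp add: has_real_derivative_iff_has_vector_derivative)
  qed (use cd in auto)
  then show ?thesis by (simp add: right_diff_distrib)
qed

text \<open>The curve runs straight from \<open>p\<close> down to \<open>a\<close> and then straight
  up to \<open>q\<close>. All coordinates stay nonnegative and above those of \<open>a\<close>, so
  the norm is affine on each half and each half has length
  \<open>artanh (taxicab_norm p) - artanh (taxicab_norm a)\<close>.\<close>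

lemma taxicab_dist_le_via_lower_bound:
  fixes a p q :: "real ^ 'n"
  assumes a: "\<And>k. 0 \<le> a $ k" "\<And>k. a $ k \<le> p $ k" "\<And>k. a $ k \<le> q $ k"
    and pq: "taxicab_norm p = taxicab_norm q" "taxicab_norm p < 1"
  shows "taxicab_dist p q \<le> 2 * (artanh (taxicab_norm p) - artanh (taxicab_norm a))"
proof -
  define n where "n = taxicab_norm a"
  define D where "D = taxicab_norm p - n"
  \<comment> \<open>Clipping at 0 lets one formula describe both halves: \<open>\<alpha>\<close>
    runs from 1 to 0 on \<open>[0, 1/2]\<close> and \<open>\<beta>\<close> from 0 to 1 on
    \<open>[1/2, 1]\<close>.\<close>
  define \<alpha> \<beta> :: "real \<Rightarrow> real" where "\<alpha> t = max 0 (1 - 2 * t)" and "\<beta> t = max 0 (2 * t - 1)" for t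
  define \<gamma> where "\<gamma> t = a + \<alpha> t *\<^sub>R (p - a) + \<beta> t *\<^sub>R (q - a)" for t
  have norm_pos: "taxicab_norm v = (\<Sum>k\<in>UNIV. v $ k)" if "\<And>k. 0 \<le> v $ k" for v :: "real ^ 'n"
    using that by (simp add: taxicab_norm_def)
  have p0: "0 \<le> p $ k" and q0: "0 \<le> q $ k" for k
    using a(1,2,3)[of k] by linarith+
  have Dp: "taxicab_norm (p - a) = D" and Dq: "taxicab_norm (q - a) = D"
    using a p0 q0 pq by (simp_all add: D_def n_def norm_pos sum_subtractf)
  have D0: "0 \<le> D" using taxicab_norm_nonneg[of "p - a"] Dp by simp
  have norm: "taxicab_norm (\<gamma> t) = n + (\<alpha> t + \<beta> t) * D" for t
  proof -
    have "taxicab_norm (\<gamma> t) = (\<Sum>k\<in>UNIV. \<gamma> t $ k)"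
      using a by (intro norm_pos) (simp add: \<gamma>_def \<alpha>_def \<beta>_def)
    also have "\<dots> = (\<Sum>k\<in>UNIV. a $ k) + \<alpha> t * (\<Sum>k\<in>UNIV. (p - a) $ k) + \<beta> t * (\<Sum>k\<in>UNIV. (q - a) $ k)"
      by (simp add: \<gamma>_def sum.distrib sum_distrib_left)
    also have "\<dots> = n + \<alpha> t * D + \<beta> t * D"
      using a norm_pos[of a] norm_pos[of "p - a"] norm_pos[of "q - a"] by (simp add: n_def Dp Dq)
    finally show ?thesis by (simp add: algebra_simps)
  qed
  have less: "n + s * D < 1" if "0 \<le> s" "s \<le> 1" for s
  proof -
    have "s * D \<le> 1 * D" using that D0 by (intro mult_right_mono)
    then show ?thesis using pq(2) by (simp add: D_def)
  qed
  have "\<gamma> \<in> curves (\<gamma> 0) (\<gamma> 1)"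
  proof (rule lipschitz_curve[where C = "\<lambda>i. 2 * (p $ i - a $ i) + 2 * (q $ i - a $ i)"])
    show "taxicab_norm (\<gamma> t) < 1" if "t \<in> {0..1}" for t
      unfolding norm using that by (intro less) (auto simp: \<alpha>_def \<beta>_def)
  next
    fix u v :: real and i assume uv: "u \<le> v"
    have "\<gamma> v $ i - \<gamma> u $ i = (\<alpha> v - \<alpha> u) * (p $ i - a $ i) + (\<beta> v - \<beta> u) * (q $ i - a $ i)"
      by (simp add: \<gamma>_def algebra_simps)
    also have "\<bar>\<dots>\<bar> \<le> \<bar>\<alpha> v - \<alpha> u\<bar> * (p $ i - a $ i) + \<bar>\<beta> v - \<beta> u\<bar> * (q $ i - a $ i)"
      using a(2,3)[of i] by (intro order_trans[OF abs_triangle_ineq]) (simp add: abs_mult)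
    also have "\<dots> \<le> (2 * (v - u)) * (p $ i - a $ i) + (2 * (v - u)) * (q $ i - a $ i)"
      using a(2,3)[of i] uv by (intro add_mono mult_right_mono) (auto simp: \<alpha>_def \<beta>_def)
    finally show "\<bar>\<gamma> v $ i - \<gamma> u $ i\<bar> \<le> (2 * (p $ i - a $ i) + 2 * (q $ i - a $ i)) * (v - u)"
      by (simp add: algebra_simps)
  qed
  moreover have "\<gamma> 0 = p" "\<gamma> 1 = q" by (simp_all add: \<gamma>_def \<alpha>_def \<beta>_def)
  ultimately have \<gamma>: "\<gamma> \<in> curves p q" by simp
  \<comment> \<open>The integral is left in the affine form with \<open>m = n + D\<close>,
    \<open>k = - 2 * D\<close> and sign -1, as the norm falls from \<open>n + D\<close> to
    \<open>n\<close> on the first half.\<close>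
  have "(speed \<gamma> has_integral - 1 * (artanh ((n + D) + (- 2 * D) * (1/2)) - artanh ((n + D) + (- 2 * D) * 0))) {0..1/2}"
  proof (rule speed_has_integral_affine)
    fix t :: real assume t: "t \<in> {0<..<1/2}"
    have "((\<lambda>t. a + (1 - 2 * t) *\<^sub>R (p - a)) has_vector_derivative (- 2) *\<^sub>R (p - a)) (at t)"
      by (auto intro!: derivative_eq_intros simp: has_vector_derivative_def)
    then show "(\<gamma> has_vector_derivative (- 2) *\<^sub>R (p - a)) (at t)"
      by (rule has_vector_derivative_transform_within_open[where S = "{0<..<1/2}"])
        (use t in \<open>auto simp: \<gamma>_def \<alpha>_def \<beta>_def\<close>)
  next
    fix t :: real assume t: "t \<in> {0..1/2}"
    show "taxicab_norm (\<gamma> t) = (n + D) + (- 2 * D) * t"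
      unfolding norm using t by (simp add: \<alpha>_def \<beta>_def algebra_simps)
    show "(n + D) + (- 2 * D) * t < 1"
      using less[of "1 - 2 * t"] t by (simp add: algebra_simps)
  qed (use Dp in \<open>simp_all add: taxicab_norm_scaleR del: scaleR_minus_left\<close>)
  then have "(speed \<gamma> has_integral artanh (n + D) - artanh n) {0..1/2}"
    by (simp add: algebra_simps)
  moreover
  have "(speed \<gamma> has_integral 1 * (artanh ((n - D) + (2 * D) * 1) - artanh ((n - D) + (2 * D) * (1/2)))) {1/2..1}"
  proof (rule speed_has_integral_affine)
    fix t :: real assume t: "t \<in> {1/2<..<1}"
    have "((\<lambda>t. a + (2 * t - 1) *\<^sub>R (q - a)) has_vector_derivative 2 *\<^sub>R (q - a)) (at t)"
      by (auto intro!: derivative_eq_intros simp: has_vector_derivative_def)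
    then show "(\<gamma> has_vector_derivative 2 *\<^sub>R (q - a)) (at t)"
      by (rule has_vector_derivative_transform_within_open[where S = "{1/2<..<1}"])
        (use t in \<open>auto simp: \<gamma>_def \<alpha>_def \<beta>_def\<close>)
  next
    fix t :: real assume t: "t \<in> {1/2..1}"
    show "taxicab_norm (\<gamma> t) = (n - D) + (2 * D) * t"
      unfolding norm using t by (simp add: \<alpha>_def \<beta>_def algebra_simps)
    show "(n - D) + (2 * D) * t < 1"
      using less[of "2 * t - 1"] t by (simp add: algebra_simps)
  qed (use Dq in \<open>simp_all add: taxicab_norm_scaleR\<close>)
  then have "(speed \<gamma> has_integral artanh (n + D) - artanh n) {1/2..1}"
    by (simp add: algebra_simps)
  ultimately have "(speed \<gamma> has_integral 2 * (artanh (n + D) - artanh n)) {0..1}"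
    using has_integral_combine[of 0 "1/2" 1 "speed \<gamma>" "artanh (n + D) - artanh n" "artanh (n + D) - artanh n"]
    by simp
  then have "curve_length \<gamma> = 2 * (artanh (n + D) - artanh n)"
    unfolding curve_length_eq[OF \<gamma>] by (rule integral_unique)
  then show ?thesis using taxicab_dist_le[OF \<gamma>] by (simp add: D_def n_def)
qed

section \<open>Three points in a coordinate plane without a median\<close>

lemma sum_eq_two:
  fixes f :: "'n::finite \<Rightarrow> real"
  assumes "i \<noteq> j" "\<And>k. k \<noteq> i \<Longrightarrow> k \<noteq> j \<Longrightarrow> f k = 0"
  shows "sum f UNIV = f i + f j"
proof -
  have "sum f UNIV = sum f {i, j}"
    using assms by (intro sum.mono_neutral_right) auto
  then show ?thesis using assms(1) by simp
qed

definition plane_point :: "'n \<Rightarrow> 'n \<Rightarrow> real \<Rightarrow> real \<Rightarrow> real ^ 'n" where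
  "plane_point i j x y = (\<chi> k. if k = i then x else if k = j then y else 0)"

lemma plane_point_nth: "plane_point i j x y $ k = (if k = i then x else if k = j then y else 0)"
  by (simp add: plane_point_def)

lemma taxicab_norm_plane_point:
  assumes "i \<noteq> j"
  shows "taxicab_norm (plane_point i j x y) = \<bar>x\<bar> + \<bar>y\<bar>"
  unfolding taxicab_norm_def using assms by (subst sum_eq_two[OF assms]) (auto simp: plane_point_nth)

lemma meet_norm_plane_point:
  assumes "i \<noteq> j"
  shows "meet_norm (plane_point i j x y) w = max 0 (min (w $ i) x) + max 0 (min (w $ j) y)"
  unfolding meet_norm_def using assms by (subst sum_eq_two[OF assms]) (auto simp: plane_point_nth)

lemma taxicab_dist_plane_point_le:
  assumes "i \<noteq> j" "0 \<le> x" "0 \<le> y" "x \<le> x1" "y \<le> y1" "x \<le> x2" "y \<le> y2"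
    and "x1 + y1 = x2 + y2" "x1 + y1 < 1"
  shows "taxicab_dist (plane_point i j x1 y1) (plane_point i j x2 y2) \<le>
    2 * (artanh (x1 + y1) - artanh (x + y))"
proof -
  have "taxicab_dist (plane_point i j x1 y1) (plane_point i j x2 y2) \<le>
      2 * (artanh (taxicab_norm (plane_point i j x1 y1)) - artanh (taxicab_norm (plane_point i j x y)))"
    using assms by (intro taxicab_dist_le_via_lower_bound)
      (auto simp: taxicab_norm_plane_point plane_point_nth)
  then show ?thesis using assms by (simp add: taxicab_norm_plane_point)
qed

lemma not_supports_median_plane_points:
  fixes i j :: "'n::finite"
  assumes ij: "i \<noteq> j"
  shows "\<not> supports_median taxicab_ball taxicab_dist
    (plane_point i j (1/2) 0) (plane_point i j (1/4) (1/4)) (plane_point i j 0 (1/2))"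
    (is "\<not> supports_median _ _ ?p ?q ?r")
proof
  assume "supports_median taxicab_ball taxicab_dist ?p ?q ?r"
  then obtain m where m: "m \<in> taxicab_ball"
    "taxicab_dist ?p ?q = taxicab_dist ?p m + taxicab_dist m ?q"
    "taxicab_dist ?q ?r = taxicab_dist ?q m + taxicab_dist m ?r"
    "taxicab_dist ?r ?p = taxicab_dist ?r m + taxicab_dist m ?p"
    unfolding supports_median_def metric_interval_def by blast
  define \<rho> where "\<rho> = taxicab_norm m"
  define X Y x y where "X = max 0 (min (m $ i) (1/2))" and "Y = max 0 (min (m $ j) (1/2))"
    and "x = max 0 (min (m $ i) (1/4))" and "y = max 0 (min (m $ j) (1/4))"
  \<comment> \<open>A point's potential at itself is \<open>- artanh (1/2)\<close>, so this is the
    potential bound between \<open>a\<close> and \<open>m\<close>. Both orders of the arguments are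
    recorded because the interval conditions use both.\<close>
  have low: "artanh \<rho> - 2 * artanh (meet_norm a m) + artanh (1/2) \<le> taxicab_dist a m"
    "artanh \<rho> - 2 * artanh (meet_norm a m) + artanh (1/2) \<le> taxicab_dist m a"
    if "a \<in> {?p, ?q, ?r}" for a
  proof -
    have a: "a \<in> taxicab_ball" "\<And>k. a $ k \<ge> 0" "taxicab_norm a = 1/2" "meet_norm a a = 1/2"
      using that ij
      by (auto simp: taxicab_ball_def taxicab_norm_plane_point meet_norm_plane_point[OF ij] plane_point_nth)
    show "artanh \<rho> - 2 * artanh (meet_norm a m) + artanh (1/2) \<le> taxicab_dist a m"
      "artanh \<rho> - 2 * artanh (meet_norm a m) + artanh (1/2) \<le> taxicab_dist m a"
      using potential_le_taxicab_dist[OF a(2,1) m(1)] potential_le_taxicab_dist[OF a(2) m(1) a(1)]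
      by (simp_all add: potential_def a(3,4) \<rho>_def)
  qed
  have meets: "meet_norm ?p m = X" "meet_norm ?q m = x + y" "meet_norm ?r m = Y"
    by (simp_all add: meet_norm_plane_point[OF ij] X_def Y_def x_def y_def)
  \<comment> \<open>The common lower bounds are the pairwise meets \<open>(1/4, 0)\<close>,
    \<open>(0, 1/4)\<close> and the origin.\<close>
  have up: "taxicab_dist ?p ?q \<le> 2 * (artanh (1/2) - artanh (1/4))"
    "taxicab_dist ?q ?r \<le> 2 * (artanh (1/2) - artanh (1/4))"
    "taxicab_dist ?r ?p \<le> 2 * artanh (1/2)"
    using taxicab_dist_plane_point_le[OF ij, of "1/4" 0 "1/2" 0 "1/4" "1/4"]
      taxicab_dist_plane_point_le[OF ij, of 0 "1/4" "1/4" "1/4" 0 "1/2"]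
      taxicab_dist_plane_point_le[OF ij, of 0 0 0 "1/2" "1/2" 0] by simp_all
  \<comment> \<open>Positivity of this value makes the two inequalities that involve
    \<open>?q\<close> strict: there the upper bound on the distance is smaller by
    \<open>2 * artanh (1/4)\<close>.\<close>
  have "artanh (1/4 :: real) > 0"
    using artanh_superadditive[of "1/8" "1/8"] artanh_diff_le(1)[of 0 "1/8" "1/8"] by simp
  then have outer: "artanh \<rho> \<le> artanh X + artanh Y" "artanh \<rho> < artanh X + artanh (x + y)"
    "artanh \<rho> < artanh (x + y) + artanh Y"
    using low(1)[of ?p] low(2)[of ?p] low(1)[of ?q] low(2)[of ?q] low(1)[of ?r] low(2)[of ?r] m(2-4) up
    by (simp_all add: meets)
  \<comment> \<open>Each left-hand side is the norm of the meet of \<open>m\<close> with a suitable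
    auxiliary point of the plane.\<close>
  have "X + Y \<le> \<rho>" and "x \<le> \<rho>" "y \<le> \<rho>"
  proof -
    show "X + Y \<le> \<rho>" using meet_norm_le[of "plane_point i j (1/2) (1/2)" m]
      by (simp add: meet_norm_plane_point[OF ij] X_def Y_def \<rho>_def)
    show "x \<le> \<rho>" using meet_norm_le[of "plane_point i j (1/4) 0" m]
      by (simp add: meet_norm_plane_point[OF ij] x_def \<rho>_def)
    show "y \<le> \<rho>" using meet_norm_le[of "plane_point i j 0 (1/4)" m]
      by (simp add: meet_norm_plane_point[OF ij] y_def \<rho>_def)
  qed
  moreover have "\<rho> < 1" using m(1) by (simp add: taxicab_ball_def \<rho>_def)
  moreover have nonneg: "0 \<le> X" "0 \<le> Y" "0 \<le> x" "0 \<le> y" by (simp_all add: X_def Y_def x_def y_def)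
  ultimately have mono: "artanh (X + Y) \<le> artanh \<rho>" "artanh x \<le> artanh \<rho>" "artanh y \<le> artanh \<rho>"
    by (auto intro!: artanh_diff_le(1)[where R = \<rho>])
  \<comment> \<open>If both were positive, then
    \<open>artanh X + artanh Y < artanh (X + Y) \<le> artanh \<rho>\<close>, against the first
    inequality of \<open>outer\<close>.\<close>
  have "X = 0 \<or> Y = 0"
    using artanh_superadditive[of X Y] \<open>X + Y \<le> \<rho>\<close> \<open>\<rho> < 1\<close> nonneg outer(1) mono(1) by fastforce
  then show False
  proof
    \<comment> \<open>Here coordinate \<open>i\<close> of \<open>m\<close> is not positive, so
      \<open>x\<close> vanishes too and the second inequality of \<open>outer\<close> becomes
      \<open>artanh \<rho> < artanh y\<close>, against \<open>y \<le> \<rho>\<close>. The other case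
      is symmetric.\<close>
    assume "X = 0"
    then have "x = 0" by (auto simp: X_def x_def max_def min_def split: if_splits)
    then show False using \<open>X = 0\<close> outer(2) mono(3) by simp
  next
    assume "Y = 0"
    then have "y = 0" by (auto simp: Y_def y_def max_def min_def split: if_splits)
    then show False using \<open>Y = 0\<close> outer(3) mono(2) by simp
  qed
qed

theorem corollary5p5:
  assumes "CARD('n::finite) \<ge> 2"
  shows "\<not> median_space (taxicab_ball :: (real ^ 'n) set) taxicab_dist"
proof
  assume median: "median_space (taxicab_ball :: (real ^ 'n) set) taxicab_dist"
  have "\<not> card (UNIV :: 'n set) \<le> Suc 0" using assms by simp
  then obtain i j :: 'n where ij: "i \<noteq> j"
    using card_le_Suc0_iff_eq[of "UNIV :: 'n set"] by auto
  have "plane_point i j (1/2) 0 \<in> taxicab_ball" "plane_point i j (1/4) (1/4) \<in> taxicab_ball"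
    "plane_point i j 0 (1/2) \<in> taxicab_ball"
    by (simp_all add: taxicab_ball_def taxicab_norm_plane_point[OF ij])
  then show False
    using median not_supports_median_plane_points[OF ij] unfolding median_space_def by blast
qed

end
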